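(* Let $q\in[0,2]$ and let $\hat r$ be a least-squares estimator $$\hat r\in\mathop{\mathrm{argmin}}_{r\in\mathcal R}\sum_{1\le i\ne j\le n}\left(X_{ij}-\mu_{r(i)r(j)}\right)^2 .$$ Assume the noise condition (N), the signal condition (S) and the upper signal condition (U). Then there exist a constant $C>0$ independent of $n$ and a sequence $\eta_n\to0$ such that, for all $n$, $$\sup_{r\in\mathcal R}\mathbb E_r\,\ell_q(\hat r,r)\le C\begin{cases}\exp\left(-(1+\eta_n)s_n\right), & s_n>1,\\[2pt] s_n^{-q/2}\wedge n^q, & s_n\le 1,\end{cases}\qquad\text{where } s_n=\frac{n\beta^2}{4\sigma^2}.$$ (If $\beta=0$, the bound in the second case is read as $n^q$.)
   Context: Write $[n]=\{1,\dots,n\}$, $a\wedge b=\min(a,b)$, and let $\|\cdot\|$ be the Euclidean norm on $\mathbb R^n$. All model quantities may depend on $n$ (except the constant $M$), and asymptotics are as $n\to\infty$. Rank space: $\mathcal R=\{r=(r(1),\dots,r(n))\in[n]^n:\ |\sum_{i=1}^n r(i)-\sum_{i=1}^n i|\le c_n\}$, where $c_n$ satisfies $1\le c_n=o(\sqrt n)$. Model: $(\mu_{kl})_{k,l\in[n]}$ is a known real array. For $r\in\mathcal R$, $\mathbb P_r$ (with expectation $\mathbb E_r$) is the law of the observations $\{X_{ij}\}_{1\le i\ne j\le n}$, $X_{ij}=\mu_{r(i)r(j)}+Z_{ij}$. (N) Noise condition, with parameter $\sigma>0$: for every $t>0$ and all reals $(v_{ij})_{1\le i\neq j\le n}$ with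 $\sum_{i\ne j}v_{ij}^2=1$, $\mathbb P(\sum_{1\le i\ne j\le n}v_{ij}Z_{ij}>t)\le\exp(-t^2/(2\sigma^2))$. (S) Signal condition, with parameter $\beta\in\mathbb R$: for all $r,\tilde r\in\mathcal R$, $\sum_{1\le i\ne j\le n}(\mu_{\tilde r(i)\tilde r(j)}-\mu_{r(i)r(j)})^2\ge 2n\beta^2\|\tilde r-r\|^2$. (U) Upper signal condition, with the same $\beta$ and a constant $M>1$: for all $r,\tilde r\in\mathcal R$, $\sum_{1\le i\ne j\le n}(\mu_{\tilde r(i)\tilde r(j)}-\mu_{r(i)r(j)})^2\le 2Mn\beta^2\|\tilde r-r\|^2$. Loss: $\ell_0(\hat r,r)=\frac1n\sum_{i=1}^n\mathbb I\{\hat r(i)\ne r(i)\}$, and $\ell_q(\hat r,r)=\frac1n\sum_{i=1}^n|\hat r(i)-r(i)|^q$ for $q\in(0,2]$. *)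

theory Defs
  imports "HOL-Probability.Probability" "HOL-Library.Landau_Symbols"
begin

definition offdiag :: "nat \<Rightarrow> (nat \<times> nat) set" where
  "offdiag n = {(i, j). i \<in> {1..n} \<and> j \<in> {1..n} \<and> i \<noteq> j}"

text \<open>Rank vectors are functions on \<open>{1..n}\<close>, with the dummy value \<open>undefined\<close> elsewhere.\<close>

definition rank_space :: "nat \<Rightarrow> real \<Rightarrow> (nat \<Rightarrow> nat) set" where
  "rank_space n c =
     {r \<in> {1..n} \<rightarrow>\<^sub>E {1..n}. \<bar>(\<Sum>i=1..n. real (r i)) - (\<Sum>i=1..n. real i)\<bar> \<le> c}"

definition sq_dist :: "nat \<Rightarrow> (nat \<Rightarrow> nat) \<Rightarrow> (nat \<Rightarrow> nat) \<Rightarrow> real" where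
  "sq_dist n r' r = (\<Sum>i=1..n. (real (r' i) - real (r i))\<^sup>2)"

abbreviation obs_space :: "nat \<Rightarrow> (nat \<times> nat \<Rightarrow> real) measure" where
  "obs_space n \<equiv> PiM (offdiag n) (\<lambda>_. borel)"

text \<open>The law \<open>P\<^sub>r\<close> of the array \<open>X i j = \<mu> (r i) (r j) + Z i j\<close>, \<open>i \<noteq> j\<close>, where the
  noise variables \<open>Z\<close> live on the probability space \<open>\<Omega>\<close>.\<close>

definition obs_law ::
  "nat \<Rightarrow> 'a measure \<Rightarrow> (nat \<Rightarrow> nat \<Rightarrow> 'a \<Rightarrow> real) \<Rightarrow> (nat \<Rightarrow> nat \<Rightarrow> real) \<Rightarrow> (nat \<Rightarrow> nat)
     \<Rightarrow> (nat \<times> nat \<Rightarrow> real) measure" where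
  "obs_law n \<Omega> Z \<mu> r =
     distr \<Omega> (obs_space n) (\<lambda>\<omega>. \<lambda>(i, j) \<in> offdiag n. \<mu> (r i) (r j) + Z i j \<omega>)"

definition noise_condition ::
  "nat \<Rightarrow> 'a measure \<Rightarrow> (nat \<Rightarrow> nat \<Rightarrow> 'a \<Rightarrow> real) \<Rightarrow> real \<Rightarrow> bool" where
  "noise_condition n \<Omega> Z \<sigma> \<longleftrightarrow>
     (\<forall>t>0. \<forall>v :: nat \<Rightarrow> nat \<Rightarrow> real. (\<Sum>(i, j)\<in>offdiag n. (v i j)\<^sup>2) = 1 \<longrightarrow>
        measure \<Omega> {\<omega> \<in> space \<Omega>. (\<Sum>(i, j)\<in>offdiag n. v i j * Z i j \<omega>) > t}
          \<le> exp (- t\<^sup>2 / (2 * \<sigma>\<^sup>2)))"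

definition signal_diff ::
  "nat \<Rightarrow> (nat \<Rightarrow> nat \<Rightarrow> real) \<Rightarrow> (nat \<Rightarrow> nat) \<Rightarrow> (nat \<Rightarrow> nat) \<Rightarrow> real" where
  "signal_diff n \<mu> r' r = (\<Sum>(i, j)\<in>offdiag n. (\<mu> (r' i) (r' j) - \<mu> (r i) (r j))\<^sup>2)"

definition signal_condition :: "nat \<Rightarrow> real \<Rightarrow> (nat \<Rightarrow> nat \<Rightarrow> real) \<Rightarrow> real \<Rightarrow> bool" where
  "signal_condition n c \<mu> \<beta> \<longleftrightarrow>
     (\<forall>r \<in> rank_space n c. \<forall>r' \<in> rank_space n c.
        signal_diff n \<mu> r' r \<ge> 2 * real n * \<beta>\<^sup>2 * sq_dist n r' r)"

definition upper_signal_condition ::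
  "nat \<Rightarrow> real \<Rightarrow> (nat \<Rightarrow> nat \<Rightarrow> real) \<Rightarrow> real \<Rightarrow> real \<Rightarrow> bool" where
  "upper_signal_condition n c \<mu> \<beta> M \<longleftrightarrow>
     (\<forall>r \<in> rank_space n c. \<forall>r' \<in> rank_space n c.
        signal_diff n \<mu> r' r \<le> 2 * M * real n * \<beta>\<^sup>2 * sq_dist n r' r)"

text \<open>A least-squares estimator is any measurable selection from the set of minimisers;
  ties may be broken arbitrarily.\<close>

definition least_squares_estimator ::
  "nat \<Rightarrow> real \<Rightarrow> (nat \<Rightarrow> nat \<Rightarrow> real) \<Rightarrow> ((nat \<times> nat \<Rightarrow> real) \<Rightarrow> nat \<Rightarrow> nat) \<Rightarrow> bool" where
  "least_squares_estimator n c \<mu> rhat \<longleftrightarrow>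
     rhat \<in> measurable (obs_space n) (count_space (rank_space n c)) \<and>
     (\<forall>x \<in> space (obs_space n).
        is_arg_min (\<lambda>r. \<Sum>(i, j)\<in>offdiag n. (x (i, j) - \<mu> (r i) (r j))\<^sup>2)
          (\<lambda>r. r \<in> rank_space n c) (rhat x))"

definition loss :: "real \<Rightarrow> nat \<Rightarrow> (nat \<Rightarrow> nat) \<Rightarrow> (nat \<Rightarrow> nat) \<Rightarrow> real" where
  "loss q n r' r =
     (if q = 0 then (\<Sum>i=1..n. of_bool (r' i \<noteq> r i)) / real n
      else (\<Sum>i=1..n. \<bar>real (r' i) - real (r i)\<bar> powr q) / real n)"

definition snr :: "nat \<Rightarrow> real \<Rightarrow> real \<Rightarrow> real" where
  "snr n \<beta> \<sigma> = real n * \<beta>\<^sup>2 / (4 * \<sigma>\<^sup>2)"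

text \<open>The case \<open>\<beta> = 0\<close> is separated because \<open>0 powr x = 0\<close> in the library, whereas
  \<open>s powr (- q / 2)\<close> is to be read as \<open>\<infinity>\<close> (for \<open>q > 0\<close>) at \<open>s = 0\<close>.\<close>

definition rate :: "real \<Rightarrow> nat \<Rightarrow> real \<Rightarrow> real \<Rightarrow> real \<Rightarrow> real" where
  "rate q n \<beta> \<sigma> \<eta> =
     (if snr n \<beta> \<sigma> > 1 then exp (- (1 + \<eta>) * snr n \<beta> \<sigma>)
      else if \<beta> = 0 then real n powr q
      else min (snr n \<beta> \<sigma> powr (- q / 2)) (real n powr q))"

end

theory Submission
  imports Defs
begin

text \<open>
  Write \<open>s\<close> for the signal-to-noise ratio \<open>snr n \<beta> \<sigma>\<close> and \<open>\<rho> = sq_dist n rhat r\<close> for the squared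
  error of the estimator. The minimising property gives
  \<open>signal_diff n \<mu> rhat r \<le> 2 (G rhat - G r)\<close>, where \<open>G p\<close> is the correlation of the noise with the
  signal array of \<open>p\<close>, and \<open>G p - G p'\<close> is sub-Gaussian with variance proxy
  \<open>\<sigma>\<^sup>2 signal_diff n \<mu> p p'\<close>. The theorem follows from two bounds on the mean of \<open>\<rho>\<close>, uniform in
  \<open>r\<close>; it holds with \<open>\<eta> = 0\<close>.

  If \<open>s > 1\<close>, the mean of \<open>\<rho>\<close> is at most a multiple of \<open>n exp (- s)\<close>. The signal condition gives
  \<open>P (rhat = p) \<le> exp (- s \<rho> p)\<close>, and a union bound over the lattice points \<open>p\<close> suffices: a sum of
  \<open>exp (- y \<rho> p)\<close> over all \<open>p\<close> factorises over the coordinates, and is thus at most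
  \<open>exp (10 n exp (- y))\<close>. Discarding the region \<open>\<rho> \<le> 60 n exp (- s)\<close> yields a factor that
  compensates this exponential. As \<open>\<bar>d\<bar> powr q \<le> d\<^sup>2\<close> for integers \<open>d \<noteq> 0\<close>, every loss is bounded
  by the quadratic one.

  If \<open>s \<le> 1\<close> and \<open>\<beta> \<noteq> 0\<close>, the mean of \<open>\<rho>\<close> is at most a multiple of \<open>n / s\<close>. The union bound over
  lattice points would lose a factor of order \<open>ln (1 / s)\<close>; it is removed by chaining through grids of
  side \<open>1, 2, 4, \<dots>\<close> up to the order of \<open>s powr (- 1 / 2)\<close>. The upper signal condition
  bounds the variance proxy of the links, the number of cells is again controlled by a
  factorising Gaussian sum (\<open>sum_exp_sq_dist_le_cells\<close>), and the links cannot add up to the signal once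
  \<open>\<rho>\<close> exceeds a large multiple of \<open>n / s\<close> (\<open>chaining_budget\<close>). The case of a general exponent
  follows from \<open>\<bar>d\<bar> powr q \<le> l powr q + l powr (q - 2) d\<^sup>2\<close> with \<open>l = s powr (- 1 / 2)\<close>.
\<close>

section \<open>Lattice sums of Gaussian weights\<close>

text \<open>On the natural numbers \<open>(a - b) + (b - a)\<close> is the distance of \<open>a\<close> and \<open>b\<close>, one of the truncated
  differences being \<open>0\<close>.\<close>

lemma sum_absdiff_le:
  fixes f :: "nat \<Rightarrow> real" and A :: "nat set"
  assumes "finite A" and f_nonneg: "\<And>j. 0 \<le> f j" and sums: "(\<lambda>j. f (Suc j)) sums S"
  shows "(\<Sum>a\<in>A. f ((a - b) + (b - a))) \<le> f 0 + 2 * S"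
proof -
  have one_side: "(\<Sum>a\<in>A \<inter> D. f ((a - b) + (b - a))) \<le> S"
    if inj: "inj_on (\<lambda>a. (a - b) + (b - a) - 1) (A \<inter> D)" and D: "b \<notin> D" for D
  proof -
    have "(\<Sum>a\<in>A \<inter> D. f ((a - b) + (b - a)))
        = (\<Sum>a\<in>A \<inter> D. f (Suc ((a - b) + (b - a) - 1)))"
    proof (rule sum.cong)
      fix a assume "a \<in> A \<inter> D"
      with D have "a \<noteq> b" by auto
      then show "f ((a - b) + (b - a)) = f (Suc ((a - b) + (b - a) - 1))"
        by (intro arg_cong[where f = f]) arith
    qed simp
    also have "\<dots> = (\<Sum>j\<in>(\<lambda>a. (a - b) + (b - a) - 1) ` (A \<inter> D). f (Suc j))"
      by (simp only: sum.reindex[OF inj] o_def)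
    also have "\<dots> \<le> (\<Sum>j. f (Suc j))"
      using sums \<open>finite A\<close> f_nonneg by (intro sum_le_suminf) (auto simp: sums_iff)
    finally show ?thesis using sums by (simp add: sums_iff)
  qed
  have "A = (A \<inter> {..<b}) \<union> ((A \<inter> {b<..}) \<union> (A \<inter> {b}))" by auto
  then have "(\<Sum>a\<in>A. f ((a - b) + (b - a)))
      = (\<Sum>a\<in>(A \<inter> {..<b}) \<union> ((A \<inter> {b<..}) \<union> (A \<inter> {b})). f ((a - b) + (b - a)))"
    by (rule arg_cong)
  also have "\<dots> = (\<Sum>a\<in>A \<inter> {..<b}. f ((a - b) + (b - a)))
        + ((\<Sum>a\<in>A \<inter> {b<..}. f ((a - b) + (b - a))) + (\<Sum>a\<in>A \<inter> {b}. f ((a - b) + (b - a))))"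
    using \<open>finite A\<close> by (subst sum.union_disjoint, (auto)[3], subst sum.union_disjoint) auto
  finally have "(\<Sum>a\<in>A. f ((a - b) + (b - a)))
      = (\<Sum>a\<in>A \<inter> {..<b}. f ((a - b) + (b - a)))
        + ((\<Sum>a\<in>A \<inter> {b<..}. f ((a - b) + (b - a))) + (\<Sum>a\<in>A \<inter> {b}. f ((a - b) + (b - a))))" .
  moreover have "(\<Sum>a\<in>A \<inter> {..<b}. f ((a - b) + (b - a))) \<le> S"
  proof (rule one_side)
    show "inj_on (\<lambda>a. (a - b) + (b - a) - 1) (A \<inter> {..<b})"
    proof (rule inj_onI)
      fix x y assume xy: "x \<in> A \<inter> {..<b}" "y \<in> A \<inter> {..<b}"
        and eq: "(x - b) + (b - x) - 1 = (y - b) + (b - y) - 1"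
      have "x - b = 0" "y - b = 0" using xy by simp_all
      with eq have "b - x - 1 = b - y - 1" by (simp only: add_0 add_0_right)
      moreover from xy have "x < b" "y < b" by simp_all
      ultimately show "x = y" by linarith
    qed
  qed simp
  moreover have "(\<Sum>a\<in>A \<inter> {b<..}. f ((a - b) + (b - a))) \<le> S"
  proof (rule one_side)
    show "inj_on (\<lambda>a. (a - b) + (b - a) - 1) (A \<inter> {b<..})"
    proof (rule inj_onI)
      fix x y assume xy: "x \<in> A \<inter> {b<..}" "y \<in> A \<inter> {b<..}"
        and eq: "(x - b) + (b - x) - 1 = (y - b) + (b - y) - 1"
      have "b - x = 0" "b - y = 0" using xy by simp_all
      with eq have "x - b - 1 = y - b - 1" by (simp only: add_0 add_0_right)
      moreover from xy have "b < x" "b < y" by simp_all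
      ultimately show "x = y" by linarith
    qed
  qed simp
  moreover have "(\<Sum>a\<in>A \<inter> {b}. f ((a - b) + (b - a))) \<le> f 0"
    using f_nonneg by (cases "b \<in> A") auto
  ultimately show ?thesis by linarith
qed

lemma sum_absdiff_geometric_le:
  fixes f :: "nat \<Rightarrow> real" and A :: "nat set"
  assumes "finite A" and "0 \<le> x" "x < 1" and f_nonneg: "\<And>j. 0 \<le> f j"
    and f_le: "\<And>j. f (Suc j) \<le> a * x ^ j"
  shows "(\<Sum>k\<in>A. f ((k - b) + (b - k))) \<le> f 0 + 2 * (a / (1 - x))"
proof -
  have "(\<lambda>j. a * x ^ j) sums (a * (1 / (1 - x)))"
    using assms by (intro sums_mult geometric_sums) auto
  then have g: "(\<lambda>j. a * x ^ j) sums (a / (1 - x))" by simp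
  have s: "summable (\<lambda>j. f (Suc j))"
    by (rule summable_comparison_test'[of "\<lambda>j. a * x ^ j" 0])
       (use g f_le f_nonneg in \<open>auto simp: sums_iff\<close>)
  have "(\<Sum>k\<in>A. f ((k - b) + (b - k))) \<le> f 0 + 2 * (\<Sum>j. f (Suc j))"
    by (rule sum_absdiff_le[OF \<open>finite A\<close> f_nonneg summable_sums[OF s]])
  also have "(\<Sum>j. f (Suc j)) \<le> a / (1 - x)"
    using suminf_le[OF f_le s] g by (auto simp: sums_iff)
  finally show ?thesis by linarith
qed

text \<open>The sum of a product weight over a set of vectors, here indexed injectively by \<open>P\<close>, is
  bounded by the corresponding product of one-dimensional sums.\<close>

lemma sum_prod_le_power:
  fixes F :: "'i \<Rightarrow> 'b \<Rightarrow> real"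
  assumes "finite I" "finite B" and inj: "inj_on \<phi> P" and sub: "\<phi> ` P \<subseteq> I \<rightarrow>\<^sub>E B"
    and nonneg: "\<And>i b. 0 \<le> F i b" and le: "\<And>i. i \<in> I \<Longrightarrow> (\<Sum>b\<in>B. F i b) \<le> T"
  shows "(\<Sum>p\<in>P. \<Prod>i\<in>I. F i (\<phi> p i)) \<le> T ^ card I"
proof -
  have "(\<Sum>p\<in>P. \<Prod>i\<in>I. F i (\<phi> p i)) = (\<Sum>g\<in>\<phi> ` P. \<Prod>i\<in>I. F i (g i))"
    by (simp add: sum.reindex[OF inj])
  also have "\<dots> \<le> (\<Sum>g\<in>I \<rightarrow>\<^sub>E B. \<Prod>i\<in>I. F i (g i))"
    using assms by (intro sum_mono2 finite_PiE prod_nonneg) auto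
  also have "\<dots> = (\<Prod>i\<in>I. \<Sum>b\<in>B. F i b)"
    using assms by (subst prod_sum_PiE) auto
  also have "\<dots> \<le> (\<Prod>i\<in>I. T)"
    using nonneg le by (intro prod_mono) (auto intro: sum_nonneg)
  finally show ?thesis by simp
qed

lemma of_nat_absdiff: "real ((a - b) + (b - a)) = \<bar>real a - real b\<bar>"
  by (cases "a \<le> b") (auto simp: of_nat_diff)

lemma exp_minus_mult_sum:
  "finite I \<Longrightarrow> exp (- (y * (\<Sum>i\<in>I. f i))) = (\<Prod>i\<in>I. exp (- (y * f i)) :: real)"
  by (simp only: sum_distrib_left sum_negf[symmetric] exp_sum)

text \<open>For \<open>y \<ge> 1 / 4\<close> the theta function \<open>\<Sum>k. exp (- y k\<^sup>2)\<close> exceeds \<open>1\<close> by at most a multiple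
  of \<open>exp (- y)\<close>; the sum below is bounded by its \<open>n\<close>-th power.\<close>

lemma sum_exp_sq_dist_le_large:
  assumes y: "1 / 4 \<le> y" and P: "P \<subseteq> {1..n} \<rightarrow>\<^sub>E {1..n}"
  shows "(\<Sum>p\<in>P. exp (- (y * sq_dist n p r))) \<le> exp (10 * real n * exp (- y))"
proof -
  define f :: "nat \<Rightarrow> real" where "f = (\<lambda>j. exp (- (y * (real j)\<^sup>2)))"
  define F where "F = (\<lambda>i k. f ((k - r i) + (r i - k)))"
  define x where "x = exp (- y)"
  have e: "x \<le> 4 / 5"
  proof -
    have "5 / 4 \<le> exp (1 / 4 :: real)" using exp_ge_add_one_self[of "1/4::real"] by simp
    also have "\<dots> \<le> exp y" using y by simp
    finally show ?thesis by (simp add: x_def exp_minus field_simps)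
  qed
  have x0: "0 \<le> x" by (simp add: x_def)
  have f_le: "f (Suc j) \<le> x * x ^ j" for j
  proof -
    have "real (Suc j) * 1 \<le> real (Suc j) * real (Suc j)" by (intro mult_left_mono) auto
    then have "y * real (Suc j) \<le> y * (real (Suc j))\<^sup>2"
      using y unfolding power2_eq_square by (intro mult_left_mono) auto
    then have "f (Suc j) \<le> exp (- (y * real (Suc j)))" by (simp add: f_def)
    also have "\<dots> = exp (real (Suc j) * (- y))" by simp
    also have "\<dots> = x ^ Suc j" unfolding x_def by (rule exp_of_nat_mult)
    finally show ?thesis by simp
  qed
  have coord: "(\<Sum>k\<in>{1..n}. f ((k - b) + (b - k))) \<le> exp (10 * x)" for b
  proof -
    have "(\<Sum>k\<in>{1..n}. f ((k - b) + (b - k))) \<le> f 0 + 2 * (x / (1 - x))"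
      using e x0 by (intro sum_absdiff_geometric_le f_le) (auto simp: f_def)
    also have "f 0 = 1" by (simp add: f_def)
    also have "x / (1 - x) \<le> x / (1 / 5)" using e x0 by (intro divide_left_mono) auto
    then have "1 + 2 * (x / (1 - x)) \<le> 1 + 10 * x" by simp
    also have "\<dots> \<le> exp (10 * x)" by (rule exp_ge_add_one_self)
    finally show ?thesis .
  qed
  have "(\<Sum>p\<in>P. exp (- (y * sq_dist n p r))) = (\<Sum>p\<in>P. \<Prod>i\<in>{1..n}. F i (id p i))"
    unfolding sq_dist_def
    by (simp only: F_def f_def exp_minus_mult_sum finite_atLeastAtMost of_nat_absdiff
        power2_abs id_apply)
  also have "\<dots> \<le> exp (10 * x) ^ card {1..n}"
  proof (rule sum_prod_le_power[where B = "{1..n}" and F = F and \<phi> = id])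
    show "(\<Sum>k\<in>{1..n}. F i k) \<le> exp (10 * x)" for i unfolding F_def by (rule coord)
    show "0 \<le> F i k" for i k by (simp add: F_def f_def)
  qed (use P in simp_all)
  also have "\<dots> = exp (real n * (10 * x))" by (simp add: exp_of_nat_mult)
  finally show ?thesis by (simp add: x_def mult.assoc mult.left_commute)
qed

text \<open>If \<open>P\<close> contains at most one point of each cube of side \<open>m\<close>, the sum over \<open>P\<close> of a Gaussian of
  width \<open>m / w \<ge> m\<close> is at most comparable to the volume of that Gaussian in units of the cube.\<close>

lemma sum_exp_sq_dist_le_cells:
  assumes w: "0 < w" "w \<le> 1" and m: "m > 0" and P: "P \<subseteq> {1..n} \<rightarrow>\<^sub>E {1..n}"
    and inj: "inj_on (\<lambda>p. \<lambda>i\<in>{1..n}. p i div m) P"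
  shows "(\<Sum>p\<in>P. exp (- ((w / real m)\<^sup>2 * sq_dist n p r))) \<le> (10 / w) ^ n"
proof -
  \<comment> \<open>Points in cells at index distance \<open>j > 0\<close> are at distance at least \<open>m (j - 1)\<close>.\<close>
  define f :: "nat \<Rightarrow> real"
    where "f = (\<lambda>j. exp (- ((w * (real j - 1))\<^sup>2) * of_bool (j \<noteq> 0)))"
  define F where "F = (\<lambda>i k. f ((k - r i div m) + (r i div m - k)))"
  have coord: "(\<Sum>k\<in>{0..n}. f ((k - b) + (b - k))) \<le> 10 / w" for b
  proof -
    define x where "x = exp (- 2 * w)"
    have x: "0 \<le> x" "x < 1" using w by (auto simp: x_def)
    have "f (Suc j) \<le> 3 * x ^ j" for j
    proof -
      have "2 * (w * real j) - 1 \<le> (w * real j)\<^sup>2"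
        using zero_le_power2[of "w * real j - 1"] by (simp add: power2_diff)
      then have "f (Suc j) \<le> exp (1 - 2 * (w * real j))" by (simp add: f_def)
      also have "\<dots> = exp 1 * x ^ j"
        unfolding x_def exp_of_nat_mult[symmetric] mult_exp_exp by (simp add: algebra_simps)
      also have "\<dots> \<le> 3 * x ^ j" using exp_le x by (intro mult_right_mono) auto
      finally show ?thesis .
    qed
    then have "(\<Sum>k\<in>{0..n}. f ((k - b) + (b - k))) \<le> f 0 + 2 * (3 / (1 - x))"
      using x by (intro sum_absdiff_geometric_le) (auto simp: f_def)
    also have "1 / (1 - x) \<le> 3 / (2 * w)"
    proof -
      have "1 + 2 * w \<le> exp (2 * w)" by (rule exp_ge_add_one_self)
      then have "x \<le> 1 / (1 + 2 * w)" using w by (simp add: x_def exp_minus field_simps)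
      then have "2 * w / (1 + 2 * w) \<le> 1 - x" using w by (simp add: field_simps)
      moreover have "2 * w / 3 \<le> 2 * w / (1 + 2 * w)" using w by (intro divide_left_mono) auto
      ultimately have "2 * w / 3 \<le> 1 - x" by simp
      then show ?thesis using x w by (simp add: field_simps)
    qed
    then have "f 0 + 2 * (3 / (1 - x)) \<le> 1 + 9 / w" by (simp add: f_def)
    also have "\<dots> \<le> 10 / w" using w by (simp add: field_simps)
    finally show ?thesis .
  qed
  have cell_dist: "exp (- ((w / real m)\<^sup>2 * (real k - real b)\<^sup>2))
      \<le> f ((k div m - b div m) + (b div m - k div m))" for k b
  proof (cases "(k div m - b div m) + (b div m - k div m) = 0")
    case False
    define j where "j = (k div m - b div m) + (b div m - k div m)"
    have j: "j \<noteq> 0" using False by (simp add: j_def)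
    have aux: "m * (v div m - u div m - 1) \<le> v - u" if "u \<le> v" for u v :: nat
    proof -
      have "u < m * Suc (u div m)" using m by (metis dividend_less_times_div mult_Suc_right)
      moreover have "m * (v div m) \<le> v" by simp
      moreover have "m * (v div m - u div m - 1) = m * (v div m) - m * Suc (u div m)"
        by (simp add: diff_mult_distrib2)
      ultimately show ?thesis by linarith
    qed
    have "m * (j - 1) \<le> (k - b) + (b - k)"
    proof (cases "k \<le> b")
      case True
      then show ?thesis using aux[OF True] div_le_mono[OF True, of m] by (simp add: j_def)
    next
      case False
      then have "b \<le> k" by simp
      then show ?thesis using aux[OF \<open>b \<le> k\<close>] div_le_mono[OF \<open>b \<le> k\<close>, of m] by (simp add: j_def)
    qed
    then have "real m * real (j - 1) \<le> \<bar>real k - real b\<bar>"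
      using of_nat_absdiff[of k b] by (metis of_nat_le_iff of_nat_mult)
    then have "real m * (real j - 1) \<le> \<bar>real k - real b\<bar>" using j by (simp add: of_nat_diff)
    then have "w / real m * (real m * (real j - 1)) \<le> w / real m * \<bar>real k - real b\<bar>"
      using w by (intro mult_left_mono) auto
    then have "w * (real j - 1) \<le> w / real m * \<bar>real k - real b\<bar>" using m by simp
    then have "(w * (real j - 1))\<^sup>2 \<le> (w / real m * \<bar>real k - real b\<bar>)\<^sup>2"
      using w j by (intro power_mono) auto
    then show ?thesis using j unfolding j_def[symmetric]
      by (simp add: f_def power_mult_distrib power_divide)
  qed (simp add: f_def)
  have "(\<Sum>p\<in>P. exp (- ((w / real m)\<^sup>2 * sq_dist n p r)))
      \<le> (\<Sum>p\<in>P. \<Prod>i\<in>{1..n}. F i ((\<lambda>i\<in>{1..n}. p i div m) i))"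
    unfolding sq_dist_def exp_minus_mult_sum[OF finite_atLeastAtMost]
  proof (intro sum_mono prod_mono conjI)
    fix p i assume "i \<in> {1..n}"
    then have "(\<lambda>i\<in>{1..n}. p i div m) i = p i div m" by simp
    then show "exp (- ((w / real m)\<^sup>2 * (real (p i) - real (r i))\<^sup>2))
        \<le> F i ((\<lambda>i\<in>{1..n}. p i div m) i)"
      using cell_dist[of "p i" "r i"] by (simp only: F_def)
  qed simp
  also have "\<dots> \<le> (10 / w) ^ card {1..n}"
  proof (rule sum_prod_le_power[OF _ _ inj, where B = "{0..n}" and F = F])
    show "(\<lambda>p. \<lambda>i\<in>{1..n}. p i div m) ` P \<subseteq> {1..n} \<rightarrow>\<^sub>E {0..n}"
    proof
      fix g assume "g \<in> (\<lambda>p. \<lambda>i\<in>{1..n}. p i div m) ` P"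
      then obtain p where p: "p \<in> {1..n} \<rightarrow>\<^sub>E {1..n}" "g = (\<lambda>i\<in>{1..n}. p i div m)" using P by auto
      have "p i div m \<le> n" if "i \<in> {1..n}" for i
        using PiE_mem[OF p(1) that] by (intro order_trans[OF div_le_dividend]) simp
      then show "g \<in> {1..n} \<rightarrow>\<^sub>E {0..n}"
        unfolding p(2) by (simp only: restrict_PiE_iff) simp
    qed
    show "(\<Sum>k\<in>{0..n}. F i k) \<le> 10 / w" for i unfolding F_def by (rule coord)
    show "0 \<le> F i k" for i k by (simp add: F_def f_def)
  qed simp_all
  finally show ?thesis by simp
qed

section \<open>Noise correlations and the least-squares inequality\<close>

lemma finite_offdiag [simp]: "finite (offdiag n)"
  by (rule finite_subset[of _ "{1..n} \<times> {1..n}"]) (auto simp: offdiag_def)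

lemma finite_rank_space [simp]: "finite (rank_space n c)"
  by (rule finite_subset[of _ "{1..n} \<rightarrow>\<^sub>E {1..n}"]) (auto simp: rank_space_def intro: finite_PiE)

lemma sq_dist_nonneg [simp]: "0 \<le> sq_dist n p r"
  unfolding sq_dist_def by (intro sum_nonneg) auto

lemma sq_dist_self [simp]: "sq_dist n r r = 0"
  by (simp add: sq_dist_def)

lemma sq_dist_add_le: "sq_dist n p r \<le> 2 * sq_dist n p p' + 2 * sq_dist n p' r"
proof -
  have "(x - z)\<^sup>2 \<le> 2 * (x - y)\<^sup>2 + 2 * (y - z)\<^sup>2" for x y z :: real
    using zero_le_power2[of "(x - y) - (y - z)"] by (simp add: power2_eq_square algebra_simps)
  then show ?thesis
    unfolding sq_dist_def sum_distrib_left sum.distrib[symmetric] by (intro sum_mono) auto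
qed

lemma sq_dist_commute: "sq_dist n p r = sq_dist n r p"
  by (simp add: sq_dist_def power2_commute)

lemma signal_diff_nonneg [simp]: "0 \<le> signal_diff n \<mu> p r"
  unfolding signal_diff_def by (intro sum_nonneg) auto

text \<open>The inner product of the noise with the signal array of the rank vector \<open>p\<close>.\<close>

definition noise_corr :: "nat \<Rightarrow> (nat \<Rightarrow> nat \<Rightarrow> 'a \<Rightarrow> real) \<Rightarrow> (nat \<Rightarrow> nat \<Rightarrow> real) \<Rightarrow> (nat \<Rightarrow> nat)
    \<Rightarrow> 'a \<Rightarrow> real" where
  "noise_corr n Z \<mu> p \<omega> = (\<Sum>(i, j)\<in>offdiag n. \<mu> (p i) (p j) * Z i j \<omega>)"

lemma noise_corr_diff:
  "noise_corr n Z \<mu> p \<omega> - noise_corr n Z \<mu> p' \<omega>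
     = (\<Sum>(i, j)\<in>offdiag n. (\<mu> (p i) (p j) - \<mu> (p' i) (p' j)) * Z i j \<omega>)"
  unfolding noise_corr_def sum_subtractf[symmetric] by (auto intro!: sum.cong simp: algebra_simps)

lemma least_squares_basic_inequality:
  assumes "(\<Sum>(i, j)\<in>offdiag n. (\<mu> (r i) (r j) + Z i j \<omega> - \<mu> (p i) (p j))\<^sup>2)
    \<le> (\<Sum>(i, j)\<in>offdiag n. (\<mu> (r i) (r j) + Z i j \<omega> - \<mu> (r i) (r j))\<^sup>2)"
  shows "signal_diff n \<mu> p r \<le> 2 * (noise_corr n Z \<mu> p \<omega> - noise_corr n Z \<mu> r \<omega>)"
proof -
  have "signal_diff n \<mu> p r - 2 * (noise_corr n Z \<mu> p \<omega> - noise_corr n Z \<mu> r \<omega>)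
      = (\<Sum>(i, j)\<in>offdiag n. (\<mu> (r i) (r j) + Z i j \<omega> - \<mu> (p i) (p j))\<^sup>2)
        - (\<Sum>(i, j)\<in>offdiag n. (\<mu> (r i) (r j) + Z i j \<omega> - \<mu> (r i) (r j))\<^sup>2)"
    unfolding noise_corr_diff signal_diff_def sum_distrib_left sum_subtractf[symmetric]
    by (intro sum.cong) (auto simp: power2_eq_square algebra_simps)
  then show ?thesis using assms by simp
qed

text \<open>A noise array of fixed size \<open>n\<close> that satisfies the noise condition.\<close>

locale noisy_array = prob_space \<Omega> for \<Omega> :: "'a measure" +
  fixes n :: nat and Z :: "nat \<Rightarrow> nat \<Rightarrow> 'a \<Rightarrow> real" and \<sigma> :: real
  assumes n_pos: "n \<ge> 1" and sigma_pos: "\<sigma> > 0"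
    and Z_measurable: "\<And>i j. (i, j) \<in> offdiag n \<Longrightarrow> Z i j \<in> borel_measurable \<Omega>"
    and noise: "noise_condition n \<Omega> Z \<sigma>"
begin

lemma noise_corr_measurable [measurable]: "noise_corr n Z \<mu> p \<in> borel_measurable \<Omega>"
proof -
  have "(\<lambda>\<omega>. \<mu> (p (fst e)) (p (snd e)) * Z (fst e) (snd e) \<omega>) \<in> borel_measurable \<Omega>"
    if "e \<in> offdiag n" for e
    using Z_measurable[of "fst e" "snd e"] that by (intro borel_measurable_times) auto
  then have "(\<lambda>\<omega>. \<Sum>e\<in>offdiag n. \<mu> (p (fst e)) (p (snd e)) * Z (fst e) (snd e) \<omega>)
      \<in> borel_measurable \<Omega>"
    by (intro borel_measurable_sum)
  moreover have "noise_corr n Z \<mu> p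
      = (\<lambda>\<omega>. \<Sum>e\<in>offdiag n. \<mu> (p (fst e)) (p (snd e)) * Z (fst e) (snd e) \<omega>)"
    by (auto simp: noise_corr_def fun_eq_iff case_prod_beta)
  ultimately show ?thesis by simp
qed

text \<open>The noise condition rescaled: the increment has sub-Gaussian scale \<open>\<sigma> D\<close>, where \<open>D\<^sup>2\<close> is
  the signal difference.\<close>

lemma noise_corr_tail:
  assumes t: "0 \<le> t" and E: "0 \<le> E" and le: "2 * E * \<sigma>\<^sup>2 * signal_diff n \<mu> p p' \<le> t\<^sup>2"
  shows "prob {\<omega> \<in> space \<Omega>. noise_corr n Z \<mu> p \<omega> - noise_corr n Z \<mu> p' \<omega> > t} \<le> exp (- E)"
proof -
  let ?V = "signal_diff n \<mu> p p'"
  let ?d = "\<lambda>i j. \<mu> (p i) (p j) - \<mu> (p' i) (p' j)"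
  consider "E = 0" | "?V = 0" | "E > 0" "?V > 0"
    using E signal_diff_nonneg[of n \<mu> p p'] by linarith
  then show ?thesis
  proof cases
    case 1
    then show ?thesis by simp
  next
    case 2
    have "(case e of (i, j) \<Rightarrow> (?d i j)\<^sup>2) = 0" if "e \<in> offdiag n" for e
      using that 2 unfolding signal_diff_def
      by (subst (asm) sum_nonneg_eq_0_iff) (auto split: prod.splits)
    then have z: "?d i j = 0" if "(i, j) \<in> offdiag n" for i j using that by fastforce
    have "noise_corr n Z \<mu> p \<omega> - noise_corr n Z \<mu> p' \<omega> = 0" for \<omega>
      unfolding noise_corr_diff by (rule sum.neutral) (use z in auto)
    then show ?thesis using t by simp
  next
    case 3
    \<comment> \<open>The noise condition is stated for unit vectors only.\<close>
    define s where "s = sqrt ?V"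
    have s: "s > 0" "s\<^sup>2 = ?V" using 3 by (auto simp: s_def)
    have "0 < t\<^sup>2" using le 3 sigma_pos by (smt (verit) mult_pos_pos zero_less_power2)
    then have "t > 0" using t by (simp add: zero_less_power2)
    have "(\<Sum>(i, j)\<in>offdiag n. (?d i j / s)\<^sup>2) = ?V / s\<^sup>2"
      unfolding signal_diff_def sum_divide_distrib
      by (auto intro!: sum.cong simp: power_divide)
    then have one: "(\<Sum>(i, j)\<in>offdiag n. (?d i j / s)\<^sup>2) = 1" using s 3 by simp
    have scaled: "(\<Sum>(i, j)\<in>offdiag n. ?d i j / s * Z i j \<omega>)
        = (noise_corr n Z \<mu> p \<omega> - noise_corr n Z \<mu> p' \<omega>) / s" for \<omega>
      unfolding noise_corr_diff sum_divide_distrib by (auto intro!: sum.cong)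
    have "prob {\<omega> \<in> space \<Omega>. (\<Sum>(i, j)\<in>offdiag n. ?d i j / s * Z i j \<omega>) > t / s}
        \<le> exp (- (t / s)\<^sup>2 / (2 * \<sigma>\<^sup>2))"
      using noise one \<open>t > 0\<close> s(1) unfolding noise_condition_def
      by (auto dest!: spec[of _ "t / s"] spec[of _ "\<lambda>i j. ?d i j / s"])
    also have "{\<omega> \<in> space \<Omega>. (\<Sum>(i, j)\<in>offdiag n. ?d i j / s * Z i j \<omega>) > t / s}
        = {\<omega> \<in> space \<Omega>. noise_corr n Z \<mu> p \<omega> - noise_corr n Z \<mu> p' \<omega> > t}"
      unfolding scaled using s(1) by (auto simp: divide_less_cancel)
    also have "- (t / s)\<^sup>2 / (2 * \<sigma>\<^sup>2) \<le> - E"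
      using le s 3 sigma_pos by (simp add: power_divide field_simps)
    finally show ?thesis by simp
  qed
qed

text \<open>The same bound for the closed half-line, by letting the threshold increase to \<open>t\<close>; least
  squares may choose among ties, so the event of interest is closed.\<close>

lemma noise_corr_tail_closed:
  assumes t: "0 < t" and V: "0 < signal_diff n \<mu> p p'"
  shows "prob {\<omega> \<in> space \<Omega>. noise_corr n Z \<mu> p \<omega> - noise_corr n Z \<mu> p' \<omega> \<ge> t}
    \<le> exp (- (t\<^sup>2 / (2 * \<sigma>\<^sup>2 * signal_diff n \<mu> p p')))" (is "?p \<le> _")
proof -
  let ?V = "signal_diff n \<mu> p p'"
  have le: "?p \<le> exp (- (u\<^sup>2 / (2 * \<sigma>\<^sup>2 * ?V)))" if u: "0 < u" "u < t" for u
  proof -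
    have "?p \<le> prob {\<omega> \<in> space \<Omega>. noise_corr n Z \<mu> p \<omega> - noise_corr n Z \<mu> p' \<omega> > u}"
      using u by (intro finite_measure_mono) auto
    also have "\<dots> \<le> exp (- (u\<^sup>2 / (2 * \<sigma>\<^sup>2 * ?V)))"
      using u V sigma_pos by (intro noise_corr_tail) (auto simp: field_simps)
    finally show ?thesis .
  qed
  have "((\<lambda>u. exp (- (u\<^sup>2 / (2 * \<sigma>\<^sup>2 * ?V)))) \<longlongrightarrow> exp (- (t\<^sup>2 / (2 * \<sigma>\<^sup>2 * ?V)))) (at_left t)"
    using V sigma_pos by (intro tendsto_intros) auto
  moreover have "\<forall>\<^sub>F u in at_left t. ?p \<le> exp (- (u\<^sup>2 / (2 * \<sigma>\<^sup>2 * ?V)))"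
    using eventually_at_left_real[OF t] by eventually_elim (auto intro: le)
  ultimately show ?thesis
    by (intro tendsto_lowerbound) (auto simp: trivial_limit_at_left_real)
qed

end

text \<open>A union bound for expectations: outside the region \<open>X \<le> \<tau>\<close>, one of the events \<open>A j\<close> occurs
  whose index controls the size of \<open>X\<close>.\<close>

lemma (in prob_space) expectation_le_cover:
  fixes X :: "'a \<Rightarrow> real"
  assumes "finite J" and \<tau>: "0 \<le> \<tau>" and A: "\<And>j. j \<in> J \<Longrightarrow> A j \<in> events"
    and g: "\<And>j. j \<in> J \<Longrightarrow> 0 \<le> g j" and b: "\<And>j. j \<in> J \<Longrightarrow> prob (A j) \<le> b j"
    and cover: "\<And>\<omega>. \<omega> \<in> space M \<Longrightarrow> \<tau> < X \<omega> \<Longrightarrow> \<exists>j\<in>J. \<omega> \<in> A j \<and> X \<omega> \<le> g j"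
  shows "expectation X \<le> \<tau> + (\<Sum>j\<in>J. g j * b j)"
proof -
  let ?Y = "\<lambda>\<omega>. \<tau> + (\<Sum>j\<in>J. g j * indicator (A j) \<omega>)"
  have int: "integrable M (\<lambda>\<omega>. g j * indicator (A j) \<omega>)" if "j \<in> J" for j
    using A[OF that] by (intro integrable_mult_right integrable_real_indicator)
      (auto simp: emeasure_eq_measure)
  have nn: "0 \<le> (\<Sum>j\<in>J. g j * indicator (A j) \<omega>)" for \<omega>
    using g by (intro sum_nonneg) auto
  have "expectation X \<le> expectation ?Y"
  proof (rule integral_mono')
    show "integrable M ?Y" using int by (intro Bochner_Integration.integrable_add integrable_sum) auto
    show "0 \<le> ?Y \<omega>" for \<omega> using \<tau> nn by simp
    show "X \<omega> \<le> ?Y \<omega>" if \<omega>: "\<omega> \<in> space M" for \<omega>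
    proof (cases "\<tau> < X \<omega>")
      case True
      then obtain j where j: "j \<in> J" "\<omega> \<in> A j" "X \<omega> \<le> g j" using cover \<omega> by blast
      have "g j * indicator (A j) \<omega> \<le> (\<Sum>j\<in>J. g j * indicator (A j) \<omega>)"
        using \<open>finite J\<close> j(1) g by (intro member_le_sum) auto
      then show ?thesis using j \<tau> by simp
    qed (use nn[of \<omega>] in simp)
  qed
  also have "expectation ?Y = \<tau> + (\<Sum>j\<in>J. g j * prob (A j))"
    using int A by (subst Bochner_Integration.integral_add) (auto simp: prob_space)
  also have "\<dots> \<le> \<tau> + (\<Sum>j\<in>J. g j * b j)"
    using g b by (intro add_left_mono sum_mono mult_left_mono) auto
  finally show ?thesis .
qed

section \<open>High signal-to-noise ratio\<close>

text \<open>A true rank vector \<open>r\<close> and a random rank vector \<open>rh\<close> of which only the inequality implied by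
  least squares is retained.\<close>

locale least_squares_fit = noisy_array +
  fixes c :: real and \<mu> :: "nat \<Rightarrow> nat \<Rightarrow> real" and \<beta> :: real and r :: "nat \<Rightarrow> nat"
    and rh :: "'a \<Rightarrow> nat \<Rightarrow> nat"
  assumes r_in: "r \<in> rank_space n c"
    and rh_in: "\<And>\<omega>. \<omega> \<in> space \<Omega> \<Longrightarrow> rh \<omega> \<in> rank_space n c"
    and basic: "\<And>\<omega>. \<omega> \<in> space \<Omega> \<Longrightarrow>
      signal_diff n \<mu> (rh \<omega>) r \<le> 2 * (noise_corr n Z \<mu> (rh \<omega>) \<omega> - noise_corr n Z \<mu> r \<omega>)"
    and signal: "signal_condition n c \<mu> \<beta>"
begin

lemma signal_lower:
  "p \<in> rank_space n c \<Longrightarrow> 2 * real n * \<beta>\<^sup>2 * sq_dist n p r \<le> signal_diff n \<mu> p r"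
  using signal r_in unfolding signal_condition_def by blast

lemma prob_rank_selected_le:
  assumes p: "p \<in> rank_space n c" and "\<beta> \<noteq> 0" and pos: "0 < sq_dist n p r"
  shows "prob {\<omega> \<in> space \<Omega>. noise_corr n Z \<mu> p \<omega> - noise_corr n Z \<mu> r \<omega>
      \<ge> signal_diff n \<mu> p r / 2} \<le> exp (- (snr n \<beta> \<sigma> * sq_dist n p r))"
proof -
  let ?V = "signal_diff n \<mu> p r"
  have "0 < 2 * real n * \<beta>\<^sup>2 * sq_dist n p r" using n_pos assms by simp
  with signal_lower[OF p] have V: "0 < ?V" by linarith
  have "snr n \<beta> \<sigma> * sq_dist n p r = (2 * real n * \<beta>\<^sup>2 * sq_dist n p r) / (8 * \<sigma>\<^sup>2)"
    by (simp add: snr_def)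
  also have "\<dots> \<le> ?V / (8 * \<sigma>\<^sup>2)" using signal_lower[OF p] by (intro divide_right_mono) auto
  also have "\<dots> = (?V / 2)\<^sup>2 / (2 * \<sigma>\<^sup>2 * ?V)"
    using V sigma_pos by (simp add: power2_eq_square field_simps)
  finally have "exp (- ((?V / 2)\<^sup>2 / (2 * \<sigma>\<^sup>2 * ?V))) \<le> exp (- (snr n \<beta> \<sigma> * sq_dist n p r))" by simp
  with noise_corr_tail_closed[of "?V / 2" \<mu> p r] V show ?thesis by linarith
qed

lemma expected_sq_dist_le_high_snr:
  assumes s: "1 < snr n \<beta> \<sigma>"
  shows "expectation (\<lambda>\<omega>. sq_dist n (rh \<omega>) r) \<le> 180 * (real n * exp (- snr n \<beta> \<sigma>))"
proof -
  define s where "s = snr n \<beta> \<sigma>"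
  define X where "X = real n * exp (- s)"
  \<comment> \<open>Of the exponent \<open>s \<rho>\<close>, the part \<open>\<rho> / 4\<close> absorbs the factor \<open>\<rho>\<close>, the part \<open>\<rho> / 2\<close> exploits
    \<open>\<rho> > 60 X\<close>, and the rest \<open>y \<rho>\<close> enters the lattice sum.\<close>
  define y where "y = s - 3 / 4"
  define J where "J = {p \<in> rank_space n c. 60 * X < sq_dist n p r}"
  let ?A = "\<lambda>p. {\<omega> \<in> space \<Omega>. noise_corr n Z \<mu> p \<omega> - noise_corr n Z \<mu> r \<omega> \<ge> signal_diff n \<mu> p r / 2}"
  have X: "0 \<le> X" by (simp add: X_def)
  have "\<beta> \<noteq> 0" using s by (auto simp: snr_def)
  have term_le: "sq_dist n p r * exp (- (s * sq_dist n p r)) \<le> 4 * exp (- (30 * X)) * exp (- (y * sq_dist n p r))"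
    if "p \<in> J" for p
  proof -
    let ?\<rho> = "sq_dist n p r"
    have "?\<rho> \<le> 4 * exp (?\<rho> / 4)" using exp_ge_add_one_self[of "?\<rho> / 4"] by linarith
    then have "?\<rho> * exp (- (s * ?\<rho>)) \<le> 4 * exp (?\<rho> / 4) * exp (- (s * ?\<rho>))"
      by (intro mult_right_mono) auto
    also have "\<dots> = 4 * exp (- (?\<rho> / 2)) * exp (- (y * ?\<rho>))"
      by (simp add: y_def mult_exp_exp algebra_simps)
    also have "\<dots> \<le> 4 * exp (- (30 * X)) * exp (- (y * ?\<rho>))"
      using that by (intro mult_right_mono) (auto simp: J_def)
    finally show ?thesis .
  qed
  have "expectation (\<lambda>\<omega>. sq_dist n (rh \<omega>) r)
      \<le> 60 * X + (\<Sum>p\<in>J. sq_dist n p r * exp (- (s * sq_dist n p r)))"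
  proof (rule expectation_le_cover[where A = ?A])
    show "prob (?A p) \<le> exp (- (s * sq_dist n p r))" if "p \<in> J" for p
      using that X \<open>\<beta> \<noteq> 0\<close> unfolding s_def
      by (intro prob_rank_selected_le) (auto simp: J_def)
    show "\<exists>p\<in>J. \<omega> \<in> ?A p \<and> sq_dist n (rh \<omega>) r \<le> sq_dist n p r"
      if "\<omega> \<in> space \<Omega>" "60 * X < sq_dist n (rh \<omega>) r" for \<omega>
      using that rh_in[OF that(1)] basic[OF that(1)]
      by (intro bexI[of _ "rh \<omega>"]) (simp_all add: J_def)
  qed (use X in \<open>auto simp: J_def\<close>)
  also have "(\<Sum>p\<in>J. sq_dist n p r * exp (- (s * sq_dist n p r)))
      \<le> 4 * exp (- (30 * X)) * (\<Sum>p\<in>J. exp (- (y * sq_dist n p r)))"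
    unfolding sum_distrib_left by (intro sum_mono term_le)
  also have "(\<Sum>p\<in>J. exp (- (y * sq_dist n p r))) \<le> 30 * X * exp (30 * X)"
  proof -
    \<comment> \<open>Removing the term of \<open>r\<close> itself, which is \<open>1\<close>, makes the sum of order \<open>X\<close> when \<open>X\<close> is
      small.\<close>
    have "(\<Sum>p\<in>J. exp (- (y * sq_dist n p r)))
        \<le> (\<Sum>p\<in>rank_space n c - {r}. exp (- (y * sq_dist n p r)))"
      using X by (intro sum_mono2) (auto simp: J_def)
    also have "\<dots> = (\<Sum>p\<in>rank_space n c. exp (- (y * sq_dist n p r))) - 1"
      using r_in by (simp add: sum.remove[OF finite_rank_space r_in])
    also have "(\<Sum>p\<in>rank_space n c. exp (- (y * sq_dist n p r))) \<le> exp (10 * real n * exp (- y))"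
      using s by (intro sum_exp_sq_dist_le_large) (auto simp: y_def s_def rank_space_def)
    also have "\<dots> \<le> exp (30 * X)"
    proof -
      have "exp (- y) = exp (3 / 4) * exp (- s)" by (simp add: y_def mult_exp_exp)
      also have "\<dots> \<le> 3 * exp (- s)"
      proof -
        have "exp (3 / 4 :: real) \<le> exp 1" by simp
        with exp_le have "exp (3 / 4 :: real) \<le> 3" by linarith
        then show ?thesis by (intro mult_right_mono) auto
      qed
      finally have "10 * real n * exp (- y) \<le> 10 * real n * (3 * exp (- s))"
        by (intro mult_left_mono) auto
      then show ?thesis by (simp add: X_def)
    qed
    also have "exp (30 * X) - 1 \<le> 30 * X * exp (30 * X)"
    proof -
      have "(1 - 30 * X) * exp (30 * X) \<le> exp (- (30 * X)) * exp (30 * X)"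
        using exp_ge_add_one_self[of "- (30 * X)"] by (intro mult_right_mono) auto
      then show ?thesis by (simp add: exp_minus algebra_simps)
    qed
    finally show ?thesis by simp
  qed
  also have "4 * exp (- (30 * X)) * (30 * X * exp (30 * X)) = 120 * X"
    by (simp add: exp_minus)
  finally show ?thesis by (simp add: X_def s_def)
qed

end

section \<open>Coarse approximations of rank vectors\<close>

text \<open>A representative, within the rank space, of the cell of \<open>r'\<close> in the grid of side \<open>2 ^ k\<close>.
  It has to be a rank vector because the upper signal condition speaks of nothing else; the choice
  depends on the cell only.\<close>

definition cell_rep :: "nat \<Rightarrow> real \<Rightarrow> nat \<Rightarrow> (nat \<Rightarrow> nat) \<Rightarrow> nat \<Rightarrow> nat" where
  "cell_rep n c k r' =
     (SOME p. p \<in> rank_space n c \<and> (\<forall>i\<in>{1..n}. p i div 2 ^ k = r' i div 2 ^ k))"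

lemma cell_rep:
  assumes "r' \<in> rank_space n c"
  shows cell_rep_in: "cell_rep n c k r' \<in> rank_space n c"
    and cell_rep_div: "\<And>i. i \<in> {1..n} \<Longrightarrow> cell_rep n c k r' i div 2 ^ k = r' i div 2 ^ k"
  using someI[of "\<lambda>p. p \<in> rank_space n c \<and> (\<forall>i\<in>{1..n}. p i div 2 ^ k = r' i div 2 ^ k)" r'] assms
  unfolding cell_rep_def by blast+

lemma cell_rep_cong:
  assumes "\<And>i. i \<in> {1..n} \<Longrightarrow> a i div 2 ^ k = b i div 2 ^ k"
  shows "cell_rep n c k a = cell_rep n c k b"
  unfolding cell_rep_def using assms by (intro arg_cong[where f = Eps]) auto

lemma cell_rep_0:
  assumes "r' \<in> rank_space n c"
  shows "cell_rep n c 0 r' = r'"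
proof (rule PiE_ext)
  show "cell_rep n c 0 r' \<in> {1..n} \<rightarrow>\<^sub>E {1..n}" "r' \<in> {1..n} \<rightarrow>\<^sub>E {1..n}"
    using assms cell_rep_in[OF assms, of 0] unfolding rank_space_def by blast+
  show "cell_rep n c 0 r' i = r' i" if "i \<in> {1..n}" for i
    using cell_rep_div[OF assms that, of 0] by simp
qed

lemma cell_rep_Suc:
  assumes "r' \<in> rank_space n c"
  shows "cell_rep n c (Suc k) (cell_rep n c k r') = cell_rep n c (Suc k) r'"
proof (rule cell_rep_cong)
  fix i assume "i \<in> {1..n}"
  then show "cell_rep n c k r' i div 2 ^ Suc k = r' i div 2 ^ Suc k"
    using cell_rep_div[OF assms, of i k] by (metis div_mult2_eq power_Suc2)
qed

text \<open>Distinct representatives lie in distinct cells.\<close>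

lemma inj_on_cells:
  "inj_on (\<lambda>p. \<lambda>i\<in>{1..n}. p i div 2 ^ k) (cell_rep n c k ` rank_space n c)"
proof (rule inj_onI)
  fix p p' assume p: "p \<in> cell_rep n c k ` rank_space n c" "p' \<in> cell_rep n c k ` rank_space n c"
    and eq: "(\<lambda>i\<in>{1..n}. p i div 2 ^ k) = (\<lambda>i\<in>{1..n}. p' i div 2 ^ k)"
  have fixed: "cell_rep n c k x = x" if x: "x \<in> cell_rep n c k ` rank_space n c" for x
  proof -
    obtain a where a: "a \<in> rank_space n c" "x = cell_rep n c k a" using x by (auto elim: imageE)
    have "cell_rep n c k x = cell_rep n c k a"
      unfolding a(2) by (rule cell_rep_cong) (rule cell_rep_div[OF a(1)])
    then show ?thesis using a(2) by simp
  qed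
  have "cell_rep n c k p = cell_rep n c k p'"
  proof (rule cell_rep_cong)
    show "p i div 2 ^ k = p' i div 2 ^ k" if "i \<in> {1..n}" for i
      using fun_cong[OF eq, of i] that by simp
  qed
  then show "p = p'" using fixed[OF p(1)] fixed[OF p(2)] by simp
qed

lemma sq_dist_same_cell:
  assumes "m > 0" and "\<And>i. i \<in> {1..n} \<Longrightarrow> a i div m = b i div m"
  shows "sq_dist n a b \<le> real n * (real m)\<^sup>2"
proof -
  have "(real (a i) - real (b i))\<^sup>2 \<le> (real m)\<^sup>2" if i: "i \<in> {1..n}" for i
  proof -
    have a: "a i = m * (b i div m) + a i mod m" using assms(2)[OF i] by (metis mult_div_mod_eq)
    have b: "b i = m * (b i div m) + b i mod m" by simp
    have "real (a i) - real (b i) = real (a i mod m) - real (b i mod m)"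
      using arg_cong[OF a, of real] arg_cong[OF b, of real] unfolding of_nat_add by linarith
    moreover have "real (a i mod m) < real m" "real (b i mod m) < real m"
      using \<open>m > 0\<close> by (simp_all only: of_nat_less_iff mod_less_divisor)
    moreover have "0 \<le> real (a i mod m)" "0 \<le> real (b i mod m)" by simp_all
    ultimately have "\<bar>real (a i) - real (b i)\<bar> \<le> \<bar>real m\<bar>" by linarith
    then show ?thesis by (rule abs_le_square_iff[THEN iffD1])
  qed
  then have "sq_dist n a b \<le> (\<Sum>i=1..n. (real m)\<^sup>2)" unfolding sq_dist_def by (rule sum_mono)
  then show ?thesis by simp
qed

lemma sq_dist_cell_rep:
  assumes "r' \<in> rank_space n c"
  shows "sq_dist n (cell_rep n c k r') r' \<le> real n * 4 ^ k"
proof -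
  have "sq_dist n (cell_rep n c k r') r' \<le> real n * (real (2 ^ k))\<^sup>2"
    using cell_rep_div[OF assms] by (intro sq_dist_same_cell) auto
  also have "(real (2 ^ k))\<^sup>2 = (2\<^sup>2) ^ k"
    by (simp only: of_nat_power of_nat_numeral power_mult[symmetric] mult.commute)
  finally show ?thesis by simp
qed

lemma sq_dist_cell_rep_Suc:
  assumes "r' \<in> rank_space n c"
  shows "sq_dist n r' (cell_rep n c (Suc k) r') \<le> 4 * real n * 4 ^ k"
  using sq_dist_cell_rep[OF assms, of "Suc k"] by (simp add: sq_dist_commute)

section \<open>Low signal-to-noise ratio\<close>

lemma sum_pow2_linear_weights:
  "(\<Sum>k<K. 2 ^ k * (A + 2 * real (K - k))) = 2 ^ K * (A + 4) - (A + 4) - 2 * real K"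
proof (induction K)
  case (Suc K)
  have "(\<Sum>k<Suc K. 2 ^ k * (A + 2 * real (Suc K - k)))
      = A + 2 * real (Suc K) + 2 * (\<Sum>k<K. 2 ^ k * (A + 2 * real (K - k)))"
    by (subst sum.lessThan_Suc_shift) (simp add: sum_distrib_left mult.assoc)
  also have "\<dots> = 2 ^ Suc K * (A + 4) - (A + 4) - 2 * real (Suc K)"
    unfolding Suc.IH by (simp add: algebra_simps)
  finally show ?case .
qed simp

lemma sum_half_powers_le: "(\<Sum>k\<le>K. (1 / 2 :: real) ^ (K - k)) \<le> 2"
proof -
  have "(\<Sum>k\<le>K. (1 / 2 :: real) ^ (K - k)) = (\<Sum>k\<le>K. (1 / 2) ^ k)"
    by (rule sum.reindex_bij_witness[of _ "\<lambda>k. K - k" "\<lambda>k. K - k"]) auto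
  also have "\<dots> = 2 - (1 / 2) ^ K" by (induction K) auto
  also have "\<dots> \<le> 2" by simp
  finally show ?thesis .
qed

text \<open>With entropy terms \<open>E k\<close> at scale \<open>2 ^ k\<close>, the total of the thresholds
  along a chain stays below the signal as soon as \<open>\<rho>\<close> exceeds a large multiple of \<open>N / s\<close>. The
  series over the scales is dominated by the coarsest one, so that no logarithm appears.\<close>

lemma chaining_budget:
  fixes M s N \<rho> A e b :: real and \<rho>k E :: "nat \<Rightarrow> real" and K :: nat
  assumes M: "1 < M" and s: "0 < s" and N: "1 \<le> N" and K: "2 ^ K * sqrt s \<le> 1"
    and e: "e = 1 / (24 * sqrt M)" and A: "1 \<le> A" and b: "b = 16 * sqrt M * (A + 4)"
    and \<rho>: "b\<^sup>2 * N / s < \<rho>"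
    and \<rho>k: "\<And>k. k \<le> K \<Longrightarrow> 0 \<le> \<rho>k k \<and> \<rho>k k \<le> 4 * \<rho>"
    and E: "\<And>k. E k = N * (A + 2 * real (K - k)) + 2 * e\<^sup>2 * s * \<rho>k k"
  shows "sqrt M * ((\<Sum>k<K. sqrt (4 * N * 4 ^ k) * sqrt (E k)) + sqrt (\<rho>k K) * sqrt (E K))
    < sqrt s * \<rho>"
proof -
  \<comment> \<open>Everything is compared with \<open>x\<^sup>2 = \<rho>\<close>; by assumption \<open>x > b a\<close>.\<close>
  define a x where "a = sqrt (N / s)" and "x = sqrt \<rho>"
  have sM: "1 < sqrt M" using M by simp
  have b16: "16 \<le> b"
  proof -
    have "16 * 1 * 1 \<le> 16 * sqrt M * (A + 4)" using sM A by (intro mult_mono) auto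
    then show ?thesis by (simp add: b)
  qed
  have e0: "0 < e" using sM by (simp add: e)
  have a0: "0 < a" using N s by (simp add: a_def)
  have "0 \<le> b\<^sup>2 * N / s" using N s by simp
  then have \<rho>0: "0 < \<rho>" using \<rho> by linarith
  then have x0: "0 < x" and xx: "x * x = \<rho>" by (auto simp: x_def)
  have "sqrt (b\<^sup>2 * (N / s)) < sqrt \<rho>" using \<rho> by simp
  moreover have "sqrt (b\<^sup>2 * (N / s)) = b * a" 
    unfolding real_sqrt_mult a_def using b16 by simp
  ultimately have ba: "b * a < x" by (simp only: x_def)
  have sqN: "sqrt N = a * sqrt s" using s N by (simp add: a_def real_sqrt_divide)
  have sqE: "sqrt (E k) \<le> sqrt s * (a * (A + 2 * real (K - k)) + 3 * e * x)" if "k \<le> K" for k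
  proof -
    let ?L = "A + 2 * real (K - k)"
    have L: "1 \<le> ?L" using A by simp
    have "sqrt (E k) \<le> sqrt (N * ?L) + sqrt (2 * e\<^sup>2 * s * \<rho>k k)"
      unfolding E using N L s \<rho>k[OF that] by (intro sqrt_add_le_add_sqrt) auto
    also have "sqrt (N * ?L) \<le> a * sqrt s * ?L"
    proof -
      have "?L * 1 \<le> ?L * ?L" using L by (intro mult_left_mono) auto
      then have "sqrt ?L \<le> ?L" using L by (intro real_le_lsqrt) (auto simp: power2_eq_square)
      then have "sqrt N * sqrt ?L \<le> sqrt N * ?L" using N by (intro mult_left_mono) auto
      then show ?thesis by (simp add: real_sqrt_mult sqN)
    qed
    also have "sqrt (2 * e\<^sup>2 * s * \<rho>k k) \<le> sqrt ((3 * e * sqrt s * x)\<^sup>2)"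
    proof -
      have "2 * e\<^sup>2 * s * \<rho>k k \<le> 2 * e\<^sup>2 * s * (4 * \<rho>)"
        using s \<rho>k[OF that] by (intro mult_left_mono) auto
      also have "\<dots> \<le> 9 * e\<^sup>2 * s * \<rho>" using s \<rho>0 e0 by simp
      also have "\<dots> = (3 * e * sqrt s * x)\<^sup>2"
        using s \<rho>0 by (simp add: power_mult_distrib x_def)
      finally show ?thesis by (rule real_sqrt_le_mono)
    qed
    also have "sqrt ((3 * e * sqrt s * x)\<^sup>2) = 3 * e * sqrt s * x"
      using e0 s x0 by (simp add: real_sqrt_abs)
    finally show ?thesis by (simp add: algebra_simps)
  qed
  have fine: "(\<Sum>k<K. sqrt (4 * N * 4 ^ k) * sqrt (E k)) \<le> 2 * a * sqrt s * (a * (A + 4) + 3 * e * x)"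
  proof -
    have pow: "sqrt (4 * N * 4 ^ k) = 2 * a * sqrt s * 2 ^ k" for k
    proof -
      have "sqrt (4 ^ k) = (2 :: real) ^ k" by (simp add: real_sqrt_power)
      then show ?thesis using sqN by (simp add: real_sqrt_mult)
    qed
    have geo: "(\<Sum>k<K. (2::real) ^ k) \<le> 2 ^ K" by (induction K) auto
    have "(\<Sum>k<K. sqrt (4 * N * 4 ^ k) * sqrt (E k))
        \<le> (\<Sum>k<K. 2 * a * sqrt s * 2 ^ k * (sqrt s * (a * (A + 2 * real (K - k)) + 3 * e * x)))"
      unfolding pow using a0 s by (intro sum_mono mult_left_mono sqE) auto
    also have "\<dots> = 2 * a * s * (a * (\<Sum>k<K. 2 ^ k * (A + 2 * real (K - k))) + 3 * e * x * (\<Sum>k<K. 2 ^ k))"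
    proof -
      have "2 * a * sqrt s * z * (sqrt s * (a * L + 3 * e * x))
          = 2 * a * (sqrt s * sqrt s) * (a * (z * L) + 3 * e * x * z)" for z L
        by (simp only: algebra_simps)
      then have "2 * a * sqrt s * z * (sqrt s * (a * L + 3 * e * x))
          = 2 * a * s * (a * (z * L) + 3 * e * x * z)" for z L
        using s by simp
      then show ?thesis by (simp only: sum_distrib_left sum.distrib[symmetric])
    qed
    also have "\<dots> \<le> 2 * a * s * (a * (2 ^ K * (A + 4)) + 3 * e * x * 2 ^ K)"
    proof -
      have "(\<Sum>k<K. 2 ^ k * (A + 2 * real (K - k))) \<le> 2 ^ K * (A + 4)"
        unfolding sum_pow2_linear_weights using A by simp
      then show ?thesis using a0 s e0 x0 geo
        by (intro mult_left_mono add_mono) auto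
    qed
    also have "\<dots> = 2 * a * sqrt s * ((2 ^ K * sqrt s) * (a * (A + 4) + 3 * e * x))"
    proof -
      have "2 * a * sqrt s * ((2 ^ K * sqrt s) * (a * (A + 4) + 3 * e * x))
          = 2 * a * (sqrt s * sqrt s) * (a * (2 ^ K * (A + 4)) + 3 * e * x * 2 ^ K)"
        by (simp only: algebra_simps)
      moreover have "sqrt s * sqrt s = s" using s by simp
      ultimately show ?thesis by (simp only:)
    qed
    also have "\<dots> \<le> 2 * a * sqrt s * (1 * (a * (A + 4) + 3 * e * x))"
      using K a0 s A e0 x0 by (intro mult_left_mono mult_right_mono) auto
    finally show ?thesis by simp
  qed
  have coarse: "sqrt (\<rho>k K) * sqrt (E K) \<le> (2 * x) * (sqrt s * (a * A + 3 * e * x))"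
  proof (rule mult_mono)
    have "sqrt (\<rho>k K) \<le> sqrt (4 * \<rho>)" using \<rho>k[of K] by simp
    then show "sqrt (\<rho>k K) \<le> 2 * x" by (simp add: real_sqrt_mult x_def)
    show "sqrt (E K) \<le> sqrt s * (a * A + 3 * e * x)" using sqE[of K] by simp
    show "0 \<le> sqrt (E K)" using N A s \<rho>k[of K] by (simp add: E)
  qed (use x0 in simp)
  have eM: "sqrt M * e = 1 / 24" using sM by (simp add: e)
  have "sqrt M * ((\<Sum>k<K. sqrt (4 * N * 4 ^ k) * sqrt (E k)) + sqrt (\<rho>k K) * sqrt (E K))
      \<le> sqrt M * (2 * a * sqrt s * (a * (A + 4) + 3 * e * x) + (2 * x) * (sqrt s * (a * A + 3 * e * x)))"
    using fine coarse sM by (intro mult_left_mono add_mono) auto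
  also have "\<dots> = sqrt s * (2 * a * a * (sqrt M * (A + 4)) + 2 * a * x * (sqrt M * A)
      + 6 * (sqrt M * e) * a * x + 6 * (sqrt M * e) * x * x)"
    by (simp add: algebra_simps)
  also have "\<dots> < sqrt s * (x * x)"
  proof (rule mult_strict_left_mono)
    have MA: "sqrt M * (A + 4) = b / 16" by (simp add: b)
    have "sqrt M * A \<le> sqrt M * (A + 4)" using sM by (intro mult_left_mono) auto
    then have MA': "sqrt M * A \<le> b / 16" using MA by simp
    have ax: "16 * a \<le> x" using mult_right_mono[OF b16, of a] a0 ba by linarith
    have "a * x * (sqrt M * A) \<le> a * x * (b / 16)" using MA' a0 x0 by (intro mult_left_mono) auto
    moreover have "(b * a) * x \<le> x * x" using ba x0 by (intro mult_right_mono) auto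
    moreover have "a * (b * a) \<le> x * x"
      using ba ax a0 x0 b16 by (intro mult_mono) auto
    moreover have "(16 * a) * x \<le> x * x" using ax x0 by (intro mult_right_mono) auto
    moreover have "0 < x * x" using x0 by simp
    ultimately show "2 * a * a * (sqrt M * (A + 4)) + 2 * a * x * (sqrt M * A)
      + 6 * (sqrt M * e) * a * x + 6 * (sqrt M * e) * x * x < x * x"
      unfolding MA eM by (simp add: algebra_simps)
  qed (use s in simp)
  finally show ?thesis unfolding xx .
qed

context least_squares_fit
begin

text \<open>Chaining along the representatives \<open>cell_rep n c k\<close> for \<open>k = 0, \<dots>, K\<close>, then to the
  truth \<open>r\<close>, with \<open>2 ^ K\<close> of the order of \<open>s powr (- 1 / 2)\<close>. Each link
  is a sub-Gaussian increment by the upper signal condition, and its threshold is weighted by the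
  distance to \<open>r\<close>, so that a single union bound covers all distances.\<close>

lemma expected_sq_dist_le_low_snr:
  assumes upper: "upper_signal_condition n c \<mu> \<beta> M" and M: "1 < M"
    and beta: "\<beta> \<noteq> 0" and s_le: "snr n \<beta> \<sigma> \<le> 1"
  shows "expectation (\<lambda>\<omega>. sq_dist n (rh \<omega>) r)
    \<le> ((16 * sqrt M * (480 * sqrt M + 4))\<^sup>2 + 2304 * M + 4) * (real n / snr n \<beta> \<sigma>)"
proof -
  define s where "s = snr n \<beta> \<sigma>"
  define N where "N = real n"
  define e where "e = 1 / (24 * sqrt M)"
  \<comment> \<open>\<open>A\<close> is the entropy per coordinate at the coarsest scale.\<close>
  define A where "A = 480 * sqrt M"
  define b where "b = 16 * sqrt M * (A + 4)"
  define \<rho> where "\<rho> = (\<lambda>p. sq_dist n p r)"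
  let ?R = "rank_space n c"
  have N: "1 \<le> N" using n_pos by (simp add: N_def)
  have s: "0 < s" "s \<le> 1" using beta n_pos sigma_pos s_le by (auto simp: s_def snr_def)
  have sM: "1 < sqrt M" using M by simp
  have A1: "1 \<le> A" using sM unfolding A_def by linarith
  have "1 \<le> 24 * sqrt M" using sM by linarith
  then have e0: "0 < e" "e \<le> 1" unfolding e_def by (simp_all only: zero_less_divide_1_iff divide_le_eq_1_pos)
  have b1: "1 \<le> b"
  proof -
    have "1 \<le> 16 * sqrt M" using sM by linarith
    then have "1 * 1 \<le> (16 * sqrt M) * (A + 4)" using A1 M by (intro mult_mono) auto
    then show ?thesis by (simp add: b_def)
  qed

  obtain K where K: "4 ^ K \<le> 1 / s" "1 / s < 4 ^ (K + 1)"
  proof -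
    have "1 \<le> nat \<lfloor>1 / s\<rfloor>" using s by (simp add: le_nat_floor)
    then obtain K where K: "4 ^ K \<le> nat \<lfloor>1 / s\<rfloor>" "nat \<lfloor>1 / s\<rfloor> < 4 ^ (K + 1)"
      using ex_power_ivl1[of 4 "nat \<lfloor>1 / s\<rfloor>"] by auto
    have "real (4 ^ K) \<le> real (nat \<lfloor>1 / s\<rfloor>)" using K(1) by (simp only: of_nat_le_iff)
    also have "\<dots> \<le> 1 / s" using s by simp
    finally have lo: "4 ^ K \<le> 1 / s" by simp
    have "1 / s < real (nat \<lfloor>1 / s\<rfloor>) + 1" using s by linarith
    also have "\<dots> = real (nat \<lfloor>1 / s\<rfloor> + 1)" by simp
    also have "\<dots> \<le> real (4 ^ (K + 1))" using K(2) by (simp only: of_nat_le_iff)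
    finally have "1 / s < 4 ^ (K + 1)" by simp
    with lo show ?thesis by (rule that)
  qed
  have sqrt4: "sqrt (4 ^ k) = (2 :: real) ^ k" for k by (simp add: real_sqrt_power)
  have K_le: "2 ^ K * sqrt s \<le> 1"
  proof -
    have "4 ^ K * s \<le> 1" using K(1) s by (simp add: field_simps)
    then have "sqrt (4 ^ K * s) \<le> 1" by simp
    then show ?thesis by (simp add: real_sqrt_mult sqrt4)
  qed
  have K_ge: "1 \<le> 2 * (2 ^ K * sqrt s)"
  proof -
    have "1 \<le> 4 ^ (K + 1) * s" using K(2) s by (simp add: field_simps)
    then have "1 \<le> sqrt (4 ^ (K + 1) * s)" by simp
    then show ?thesis unfolding real_sqrt_mult sqrt4 by simp
  qed
  have four_le: "4 ^ k \<le> 1 / s" if "k \<le> K" for k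
  proof -
    have "(4::real) ^ k \<le> 4 ^ K" using that by (intro power_increasing) auto
    then show ?thesis using K(1) by linarith
  qed

  define P where "P = (\<lambda>k. cell_rep n c k ` ?R)"
  \<comment> \<open>The end of the link that starts at \<open>p\<close>; it depends on \<open>p\<close> only, so that links are indexed by
    \<open>P\<close>.\<close>
  define nxt where "nxt = (\<lambda>k p. if k < K then cell_rep n c (Suc k) p else r)"
  define E where "E = (\<lambda>k p. N * (A + 2 * real (K - k)) + 2 * e\<^sup>2 * s * \<rho> p)"
  \<comment> \<open>A bound on the squared length of the link.\<close>
  define del where "del = (\<lambda>k p. if k < K then 4 * N * 4 ^ k else \<rho> p)"
  define T where "T = 2 * \<bar>\<beta>\<bar> * \<sigma> * sqrt (M * N)"
  define t where "t = (\<lambda>k p. T * (sqrt (del k p) * sqrt (E k p)))"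
  \<comment> \<open>A bound on \<open>\<rho>\<close> over the cell represented by \<open>p\<close>.\<close>
  define g where "g = (\<lambda>k p. 2 * \<rho> p + 2 * N * 4 ^ k)"
  define Ev where "Ev = (\<lambda>k p. {\<omega> \<in> space \<Omega>.
      noise_corr n Z \<mu> p \<omega> - noise_corr n Z \<mu> (nxt k p) \<omega> > t k p})"
  define J where "J = (SIGMA k:{..K}. P k)"
  have P_sub: "p \<in> ?R" if "p \<in> P k" for k p using that cell_rep_in unfolding P_def by auto
  have \<rho>0: "0 \<le> \<rho> p" for p by (simp add: \<rho>_def)
  have E0: "0 \<le> E k p" for k p using N A1 s \<rho>0[of p] by (simp add: E_def)
  have del0: "0 \<le> del k p" for k p using N \<rho>0[of p] by (simp add: del_def)
  have T0: "0 \<le> T" using M N sigma_pos by (simp add: T_def)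
  have t0: "0 \<le> t k p" for k p using T0 E0 del0 by (simp add: t_def)
  have near: "sq_dist n (cell_rep n c k r') r' \<le> N * 4 ^ k" if "r' \<in> ?R" for k r'
    using sq_dist_cell_rep[OF that] by (simp add: N_def)

  \<comment> \<open>Each link exceeds its threshold with probability at most \<open>exp (- E)\<close>.\<close>
  have tail: "prob (Ev k p) \<le> exp (- E k p)" if "p \<in> P k" for k p
    unfolding Ev_def
  proof (rule noise_corr_tail[OF t0 E0])
    have p: "p \<in> ?R" by (rule P_sub[OF that])
    have "nxt k p \<in> ?R" using cell_rep_in[OF p] r_in by (simp add: nxt_def)
    then have "signal_diff n \<mu> p (nxt k p) \<le> 2 * M * N * \<beta>\<^sup>2 * sq_dist n p (nxt k p)"
      using upper p unfolding upper_signal_condition_def N_def by blast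
    also have "\<dots> \<le> 2 * M * N * \<beta>\<^sup>2 * del k p"
    proof (rule mult_left_mono)
      show "sq_dist n p (nxt k p) \<le> del k p"
        using sq_dist_cell_rep_Suc[OF p] by (simp add: nxt_def del_def \<rho>_def N_def)
    qed (use M N in simp)
    finally have "2 * E k p * \<sigma>\<^sup>2 * signal_diff n \<mu> p (nxt k p)
        \<le> 2 * E k p * \<sigma>\<^sup>2 * (2 * M * N * \<beta>\<^sup>2 * del k p)"
      using E0 by (intro mult_left_mono) auto
    also have "\<dots> = (t k p)\<^sup>2"
      unfolding t_def T_def power_mult_distrib using E0 del0 M N
      by (simp add: power_mult_distrib)
    finally show "2 * E k p * \<sigma>\<^sup>2 * signal_diff n \<mu> p (nxt k p) \<le> (t k p)\<^sup>2" .
  qed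

  have budget: "(\<Sum>k\<le>K. t k (cell_rep n c k r')) < N * \<beta>\<^sup>2 * \<rho> r'"
    if r': "r' \<in> ?R" and big: "b\<^sup>2 * N / s < \<rho> r'" for r'
  proof -
    let ?p = "\<lambda>k. cell_rep n c k r'"
    have "1 * N / s \<le> b\<^sup>2 * N / s"
      using b1 N s by (intro divide_right_mono mult_right_mono) auto
    with big have Ns: "N / s < \<rho> r'" by simp
    have close: "\<rho> (?p k) \<le> 4 * \<rho> r'" if "k \<le> K" for k
    proof -
      have "N * 4 ^ k \<le> N * (1 / s)" using N four_le[OF that] by (intro mult_left_mono) auto
      then have "sq_dist n (?p k) r' \<le> \<rho> r'" using near[OF r', of k] Ns by simp
      then show ?thesis using sq_dist_add_le[of n "?p k" r r'] by (simp add: \<rho>_def)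
    qed
    have budget': "sqrt M * ((\<Sum>k<K. sqrt (4 * N * 4 ^ k) * sqrt (E k (?p k)))
        + sqrt (\<rho> (?p K)) * sqrt (E K (?p K))) < sqrt s * \<rho> r'"
      using close \<rho>0
      by (intro chaining_budget[OF M s(1) N K_le e_def A1 b_def big, of "\<lambda>k. \<rho> (?p k)"])
        (auto simp: E_def)
    have T_eq: "T * sqrt s = N * \<beta>\<^sup>2 * sqrt M"
    proof -
      have "sqrt s = sqrt N * \<bar>\<beta>\<bar> / (2 * \<sigma>)"
        using sigma_pos by (simp add: s_def snr_def N_def real_sqrt_divide real_sqrt_mult)
      then have "T * sqrt s
          = 2 * \<bar>\<beta>\<bar> * \<sigma> * (sqrt M * sqrt N) * (sqrt N * \<bar>\<beta>\<bar> / (2 * \<sigma>))"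
        by (simp only: T_def real_sqrt_mult)
      moreover have "2 * u * \<sigma> * (v * w) * (w * u / (2 * \<sigma>)) = (w * w) * (u * u) * v" for u v w
        using sigma_pos by (simp add: field_simps)
      moreover have "sqrt N * sqrt N = N" "\<bar>\<beta>\<bar> * \<bar>\<beta>\<bar> = \<beta>\<^sup>2"
        using N by (simp_all add: power2_eq_square)
      ultimately show ?thesis by (simp only:)
    qed
    have "(\<Sum>k\<le>K. t k (?p k)) = T * ((\<Sum>k<K. sqrt (4 * N * 4 ^ k) * sqrt (E k (?p k)))
        + sqrt (\<rho> (?p K)) * sqrt (E K (?p K)))"
      unfolding lessThan_Suc_atMost[symmetric] sum.lessThan_Suc
      by (simp add: t_def del_def sum_distrib_left distrib_left)
    then have "sqrt s * sqrt M * (\<Sum>k\<le>K. t k (?p k)) = (T * sqrt s) * (sqrt M * ((\<Sum>k<K.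
        sqrt (4 * N * 4 ^ k) * sqrt (E k (?p k))) + sqrt (\<rho> (?p K)) * sqrt (E K (?p K))))"
      by simp
    also have "\<dots> < (T * sqrt s) * (sqrt s * \<rho> r')"
      using budget' T_eq N beta M by (intro mult_strict_left_mono) auto
    also have "\<dots> = sqrt s * sqrt M * (N * \<beta>\<^sup>2 * \<rho> r')" unfolding T_eq by simp
    finally show ?thesis using s M by (simp add: mult_less_cancel_left_pos)
  qed

  have cover: "\<exists>j\<in>J. \<omega> \<in> Ev (fst j) (snd j) \<and> \<rho> (rh \<omega>) \<le> g (fst j) (snd j)"
    if \<omega>: "\<omega> \<in> space \<Omega>" and big: "b\<^sup>2 * N / s < \<rho> (rh \<omega>)" for \<omega>
  proof -
    let ?p = "\<lambda>k. cell_rep n c k (rh \<omega>)" and ?G = "\<lambda>p. noise_corr n Z \<mu> p \<omega>"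
    have r': "rh \<omega> \<in> ?R" by (rule rh_in[OF \<omega>])
    have "(\<Sum>k\<le>K. ?G (?p k) - ?G (nxt k (?p k)))
        = (\<Sum>k<K. ?G (?p k) - ?G (?p (Suc k))) + (?G (?p K) - ?G r)"
      unfolding lessThan_Suc_atMost[symmetric] sum.lessThan_Suc
      by (simp add: nxt_def cell_rep_Suc[OF r'])
    also have "\<dots> = ?G (rh \<omega>) - ?G r"
      using sum_lessThan_telescope'[of "\<lambda>k. ?G (?p k)" K] by (simp add: cell_rep_0[OF r'])
    finally have tele: "(\<Sum>k\<le>K. ?G (?p k) - ?G (nxt k (?p k))) = ?G (rh \<omega>) - ?G r" .
    have "N * \<beta>\<^sup>2 * \<rho> (rh \<omega>) \<le> ?G (rh \<omega>) - ?G r"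
      using signal_lower[OF r'] basic[OF \<omega>] by (simp add: N_def \<rho>_def)
    with budget[OF r' big] tele
    have "(\<Sum>k\<le>K. t k (?p k)) < (\<Sum>k\<le>K. ?G (?p k) - ?G (nxt k (?p k)))" by linarith
    then obtain k where k: "k \<le> K" "t k (?p k) < ?G (?p k) - ?G (nxt k (?p k))"
      by (meson atMost_iff not_le sum_mono)
    have "\<rho> (rh \<omega>) \<le> g k (?p k)"
      using sq_dist_add_le[of n "rh \<omega>" r "?p k"] near[OF r', of k]
      by (simp add: \<rho>_def g_def sq_dist_commute[of n "rh \<omega>"])
    then show ?thesis
      using k \<omega> r' by (intro bexI[of _ "(k, ?p k)"]) (auto simp: J_def P_def Ev_def)
  qed

  \<comment> \<open>The contribution of one scale decays geometrically below the coarsest one. Half of the exponent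
    \<open>2 e\<^sup>2 s \<rho>\<close> absorbs the factor \<open>g\<close>, the other half is summed over the cells.\<close>
  have level: "(\<Sum>p\<in>P k. g k p * exp (- E k p)) \<le> (2 / e\<^sup>2 + 2 * N) / s * (1 / 2) ^ (K - k)"
    if k: "k \<le> K" for k
  proof -
    define w where "w = e * sqrt s * 2 ^ k"
    let ?j = "K - k"
    have w0: "0 < w" using e0 s by (simp add: w_def)
    have two: "2 ^ K = (2::real) ^ k * 2 ^ ?j" using k by (simp flip: power_add)
    have "sqrt s * 2 ^ k \<le> sqrt s * 2 ^ K" using k s by (intro mult_left_mono power_increasing) auto
    then have "sqrt s * 2 ^ k \<le> 1" using K_le by (simp add: mult.commute)
    then have "e * (sqrt s * 2 ^ k) \<le> 1 * 1" using e0 s by (intro mult_mono) auto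
    then have w1: "w \<le> 1" by (simp add: w_def)
    have w_eq: "(w / real (2 ^ k))\<^sup>2 = e\<^sup>2 * s"
      using s by (simp add: w_def power_mult_distrib)
    have term_le: "g k p * exp (- E k p) \<le> (2 / e\<^sup>2 + 2 * N) / s * exp (- (N * (A + 2 * real ?j)))
        * exp (- (e\<^sup>2 * s * \<rho> p))" for p
    proof -
      let ?u = "e\<^sup>2 * s * \<rho> p"
      have es: "0 < e\<^sup>2 * s" using e0 s by simp
      have u0: "0 \<le> ?u" using es \<rho>0[of p] by simp
      have "g k p \<le> (2 / e\<^sup>2 + 2 * N) / s * exp ?u"
      proof -
        have "?u \<le> exp ?u" using exp_ge_add_one_self[of ?u] by linarith
        then have "2 * \<rho> p \<le> 2 / (e\<^sup>2 * s) * exp ?u" using es by (simp add: field_simps)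
        moreover have "2 * N * 4 ^ k \<le> 2 * N * (1 / s) * 1"
          using mult_left_mono[OF four_le[OF k], of "2 * N"] N by simp
        moreover have "2 * N * (1 / s) * 1 \<le> 2 * N * (1 / s) * exp ?u"
          using N s u0 by (intro mult_left_mono) auto
        ultimately have "g k p \<le> 2 / (e\<^sup>2 * s) * exp ?u + 2 * N * (1 / s) * exp ?u"
          unfolding g_def by linarith
        then show ?thesis by (simp add: add_divide_distrib distrib_right)
      qed
      then have "g k p * exp (- E k p) \<le> (2 / e\<^sup>2 + 2 * N) / s * exp ?u * exp (- E k p)"
        by (intro mult_right_mono) auto
      moreover have "exp ?u * exp (- E k p) = exp (- (N * (A + 2 * real ?j))) * exp (- ?u)"
        by (simp add: E_def mult_exp_exp)
      ultimately show ?thesis by (simp only: mult.assoc)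
    qed
    have "(\<Sum>p\<in>P k. g k p * exp (- E k p))
        \<le> (2 / e\<^sup>2 + 2 * N) / s * exp (- (N * (A + 2 * real ?j))) * (\<Sum>p\<in>P k. exp (- (e\<^sup>2 * s * \<rho> p)))"
      unfolding sum_distrib_left by (intro sum_mono term_le)
    also have "\<dots> \<le> (2 / e\<^sup>2 + 2 * N) / s * exp (- (N * (A + 2 * real ?j))) * (10 / w) ^ n"
    proof (rule mult_left_mono)
      have "P k \<subseteq> {1..n} \<rightarrow>\<^sub>E {1..n}" using P_sub unfolding rank_space_def by blast
      then have "(\<Sum>p\<in>P k. exp (- ((w / real (2 ^ k))\<^sup>2 * sq_dist n p r))) \<le> (10 / w) ^ n"
        by (rule sum_exp_sq_dist_le_cells[OF w0 w1 zero_less_power[OF zero_less_numeral]])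
          (simp only: P_def inj_on_cells)
      then show "(\<Sum>p\<in>P k. exp (- (e\<^sup>2 * s * \<rho> p))) \<le> (10 / w) ^ n"
        by (simp only: w_eq \<rho>_def)
    qed (use N s in simp)
    also have "\<dots> = (2 / e\<^sup>2 + 2 * N) / s * (exp (- (A + 2 * real ?j)) * (10 / w)) ^ n"
    proof -
      have "exp (- (N * (A + 2 * real ?j))) = exp (- (A + 2 * real ?j)) ^ n"
        unfolding exp_of_nat_mult[symmetric] by (simp only: N_def mult_minus_right)
      then show ?thesis by (simp only: power_mult_distrib mult.assoc)
    qed
    also have "\<dots> \<le> (2 / e\<^sup>2 + 2 * N) / s * (1 / 2) ^ ?j"
    proof (rule mult_left_mono)
      have "10 / w \<le> A * 2 ^ ?j"
      proof -
        have Ae: "A * e = 20" using sM by (simp add: A_def e_def)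
        have "A * 2 ^ ?j * w = (A * e) * (2 ^ K * sqrt s)" by (simp add: w_def two)
        then have "10 \<le> A * 2 ^ ?j * w" unfolding Ae using K_ge by linarith
        then show ?thesis using w0 by (simp add: field_simps)
      qed
      also have "\<dots> \<le> exp A * 2 ^ ?j"
      proof (rule mult_right_mono)
        show "A \<le> exp A" using exp_ge_add_one_self[of A] by linarith
      qed simp
      finally have "exp (- (A + 2 * real ?j)) * (10 / w) \<le> exp (- (A + 2 * real ?j)) * (exp A * 2 ^ ?j)"
        by (intro mult_left_mono) auto
      also have "\<dots> = exp (- (2 * real ?j)) * 2 ^ ?j"
        by (simp only: mult.assoc[symmetric] mult_exp_exp) simp
      also have "\<dots> = (exp (- 2) * 2) ^ ?j"
        by (simp add: power_mult_distrib exp_of_nat_mult[symmetric] mult.commute)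
      also have "\<dots> \<le> (1 / 2) ^ ?j"
      proof (rule power_mono)
        have "4 \<le> exp (2 :: real)"
          using mult_mono[of 2 "exp 1" 2 "exp 1 :: real"] exp_ge_add_one_self[of "1::real"]
          by (simp add: mult_exp_exp)
        then show "exp (- 2) * 2 \<le> (1 / 2 :: real)" by (simp add: exp_minus field_simps)
      qed simp
      finally have le: "exp (- (A + 2 * real ?j)) * (10 / w) \<le> (1 / 2) ^ ?j" .
      have nn: "0 \<le> exp (- (A + 2 * real ?j)) * (10 / w)" using w0 by simp
      have "(exp (- (A + 2 * real ?j)) * (10 / w)) ^ n \<le> (exp (- (A + 2 * real ?j)) * (10 / w)) ^ 1"
        using n_pos by (intro power_decreasing nn order_trans[OF le power_le_one]) auto
      with le show "(exp (- (A + 2 * real ?j)) * (10 / w)) ^ n \<le> (1 / 2) ^ ?j" by simp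
    qed (use N s in simp)
    finally show ?thesis .
  qed

  have "expectation (\<lambda>\<omega>. \<rho> (rh \<omega>))
      \<le> b\<^sup>2 * N / s + (\<Sum>j\<in>J. g (fst j) (snd j) * exp (- E (fst j) (snd j)))"
  proof (rule expectation_le_cover[OF _ _ _ _ _ cover])
    show "finite J" by (simp add: J_def P_def)
    show "0 \<le> b\<^sup>2 * N / s" using N s by simp
    show "Ev (fst j) (snd j) \<in> events" for j unfolding Ev_def by measurable
    show "0 \<le> g (fst j) (snd j)" for j using N \<rho>0 by (simp add: g_def)
    show "prob (Ev (fst j) (snd j)) \<le> exp (- E (fst j) (snd j))" if "j \<in> J" for j
      using that by (intro tail) (auto simp: J_def)
  qed
  also have "(\<Sum>j\<in>J. g (fst j) (snd j) * exp (- E (fst j) (snd j)))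
      = (\<Sum>k\<le>K. \<Sum>p\<in>P k. g k p * exp (- E k p))"
    unfolding J_def by (subst sum.Sigma) (auto simp: P_def case_prod_beta)
  also have "\<dots> \<le> (\<Sum>k\<le>K. (2 / e\<^sup>2 + 2 * N) / s * (1 / 2) ^ (K - k))"
    by (intro sum_mono level) auto
  also have "\<dots> = (2 / e\<^sup>2 + 2 * N) / s * (\<Sum>k\<le>K. (1 / 2) ^ (K - k))"
    by (simp add: sum_distrib_left)
  also have "\<dots> \<le> (2 / e\<^sup>2 + 2 * N) / s * 2"
    using N s by (intro mult_left_mono sum_half_powers_le) auto
  also have "\<dots> \<le> (2 / e\<^sup>2 * N + 2 * N) / s * 2"
    using N s mult_left_mono[OF N, of "2 / e\<^sup>2"]
    by (intro mult_right_mono divide_right_mono add_right_mono) auto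
  also have "\<dots> = (4 * (1 / e\<^sup>2) + 4) * (N / s)"
    by (simp add: add_divide_distrib distrib_right)
  also have "1 / e\<^sup>2 = 576 * M" using M by (simp add: e_def power_mult_distrib power_divide)
  finally show ?thesis by (simp add: \<rho>_def b_def A_def N_def s_def algebra_simps)
qed

end

section \<open>Losses of arbitrary exponent\<close>

text \<open>A coordinatewise bound by \<open>a + b d\<^sup>2\<close> averages to a bound on the loss.\<close>

lemma loss_le_of_coordinates:
  assumes "n \<ge> 1"
    and "\<And>i. i \<in> {1..n} \<Longrightarrow> q = 0 \<Longrightarrow> r' i \<noteq> r i \<Longrightarrow> 1 \<le> a + b * (real (r' i) - real (r i))\<^sup>2"
    and "\<And>i. i \<in> {1..n} \<Longrightarrow> q \<noteq> 0 \<Longrightarrow>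
      \<bar>real (r' i) - real (r i)\<bar> powr q \<le> a + b * (real (r' i) - real (r i))\<^sup>2"
    and "0 \<le> a"
  shows "loss q n r' r \<le> a + b * (sq_dist n r' r / real n)"
proof -
  have "(\<Sum>i=1..n. a + b * (real (r' i) - real (r i))\<^sup>2) / real n
      = (real n * a + b * sq_dist n r' r) / real n"
    by (simp add: sum.distrib sq_dist_def sum_distrib_left)
  also have "\<dots> = a + b * (sq_dist n r' r / real n)"
    using \<open>n \<ge> 1\<close> by (simp add: field_simps)
  finally have eq: "(\<Sum>i=1..n. a + b * (real (r' i) - real (r i))\<^sup>2) / real n
      = a + b * (sq_dist n r' r / real n)" .
  show ?thesis
  proof (cases "q = 0")
    case True
    then have "of_bool (r' i \<noteq> r i) \<le> a + b * (real (r' i) - real (r i))\<^sup>2" if "i \<in> {1..n}" for i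
      using assms(2)[OF that] \<open>0 \<le> a\<close> by auto
    then have "(\<Sum>i=1..n. of_bool (r' i \<noteq> r i)) \<le> (\<Sum>i=1..n. a + b * (real (r' i) - real (r i))\<^sup>2)"
      by (rule sum_mono)
    then show ?thesis
      unfolding loss_def eq[symmetric] if_P[OF True] by (intro divide_right_mono) auto
  next
    case False
    have "(\<Sum>i=1..n. \<bar>real (r' i) - real (r i)\<bar> powr q)
        \<le> (\<Sum>i=1..n. a + b * (real (r' i) - real (r i))\<^sup>2)"
      by (rule sum_mono) (rule assms(3)[OF _ False])
    then show ?thesis
      unfolding loss_def eq[symmetric] if_not_P[OF False] by (intro divide_right_mono) auto
  qed
qed

lemma loss_le_sq_dist:
  assumes "n \<ge> 1" "q \<le> 2"
  shows "loss q n r' r \<le> sq_dist n r' r / real n"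
proof -
  have diff_ge_1: "1 \<le> \<bar>real (r' i) - real (r i)\<bar>" if "r' i \<noteq> r i" for i
    using that by (simp add: abs_if)
  have "loss q n r' r \<le> 0 + 1 * (sq_dist n r' r / real n)"
  proof (rule loss_le_of_coordinates)
    fix i
    show "1 \<le> 0 + 1 * (real (r' i) - real (r i))\<^sup>2" if "r' i \<noteq> r i"
      using power_mono[OF diff_ge_1[OF that], of 2] by simp
    show "\<bar>real (r' i) - real (r i)\<bar> powr q \<le> 0 + 1 * (real (r' i) - real (r i))\<^sup>2"
    proof (cases "r' i = r i")
      case False
      have "\<bar>real (r' i) - real (r i)\<bar> powr q \<le> \<bar>real (r' i) - real (r i)\<bar> powr 2"
        using diff_ge_1[OF False] \<open>q \<le> 2\<close> by (intro powr_mono) auto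
      also have "\<dots> = (real (r' i) - real (r i))\<^sup>2" using False by simp
      finally show ?thesis by simp
    qed simp
  qed (use assms in auto)
  then show ?thesis by simp
qed

text \<open>Splitting the coordinates at a level \<open>l\<close> replaces Jensen's inequality.\<close>

lemma loss_le_interpolated:
  assumes "n \<ge> 1" "0 \<le> q" "q \<le> 2" and l: "0 < l"
  shows "loss q n r' r \<le> l powr q + l powr (q - 2) * (sq_dist n r' r / real n)"
proof (rule loss_le_of_coordinates)
  fix i
  let ?d = "\<bar>real (r' i) - real (r i)\<bar>"
  show "?d powr q \<le> l powr q + l powr (q - 2) * (real (r' i) - real (r i))\<^sup>2"
  proof (cases "?d \<le> l")
    case True
    then have "?d powr q \<le> l powr q" using assms by (intro powr_mono2) auto
    then show ?thesis by (simp add: add_increasing2)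
  next
    case False
    then have d: "0 < ?d" "l \<le> ?d" using l by auto
    have "?d powr q = ?d powr (q - 2) * ?d powr 2" by (simp only: powr_add[symmetric] diff_add_cancel)
    also have "?d powr 2 = (real (r' i) - real (r i))\<^sup>2" using d by simp
    also have "?d powr (q - 2) * (real (r' i) - real (r i))\<^sup>2
        \<le> l powr (q - 2) * (real (r' i) - real (r i))\<^sup>2"
      using d l \<open>q \<le> 2\<close> by (intro mult_right_mono powr_mono2') auto
    finally show ?thesis by (simp add: add_increasing)
  qed
qed (use assms in \<open>auto simp: add_increasing2\<close>)

lemma loss_le_diameter:
  assumes n: "n \<ge> 1" and q: "0 \<le> q" and "r' \<in> rank_space n c" "r \<in> rank_space n c"
  shows "loss q n r' r \<le> real n powr q"
proof -
  have "loss q n r' r \<le> real n powr q + 0 * (sq_dist n r' r / real n)"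
  proof (rule loss_le_of_coordinates)
    fix i assume i: "i \<in> {1..n}"
    have "r' i \<in> {1..n}" "r i \<in> {1..n}"
      using assms(3,4) i unfolding rank_space_def by (auto dest: PiE_mem)
    then have "\<bar>real (r' i) - real (r i)\<bar> \<le> real n" by auto
    then show "\<bar>real (r' i) - real (r i)\<bar> powr q
        \<le> real n powr q + 0 * (real (r' i) - real (r i))\<^sup>2"
      using q by (simp add: powr_mono2)
  qed (use n in auto)
  then show ?thesis by simp
qed

lemma (in least_squares_fit) expected_loss_le:
  assumes upper: "upper_signal_condition n c \<mu> \<beta> M" and M: "1 < M"
    and q: "0 \<le> q" "q \<le> 2"
    and rh_measurable: "rh \<in> measurable \<Omega> (count_space (rank_space n c))"
  shows "expectation (\<lambda>\<omega>. loss q n (rh \<omega>) r)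
    \<le> (181 + ((16 * sqrt M * (480 * sqrt M + 4))\<^sup>2 + 2304 * M + 4)) * rate q n \<beta> \<sigma> 0"
proof -
  define D where "D = (16 * sqrt M * (480 * sqrt M + 4))\<^sup>2 + 2304 * M + 4"
  define s where "s = snr n \<beta> \<sigma>"
  let ?L = "expectation (\<lambda>\<omega>. loss q n (rh \<omega>) r)" and ?Q = "expectation (\<lambda>\<omega>. sq_dist n (rh \<omega>) r)"
  have D: "0 \<le> D" using M by (simp add: D_def)
  have int: "integrable \<Omega> (\<lambda>\<omega>. sq_dist n (rh \<omega>) r)"
  proof (rule integrable_const_bound)
    show "AE \<omega> in \<Omega>. norm (sq_dist n (rh \<omega>) r) \<le> (\<Sum>p\<in>rank_space n c. sq_dist n p r)"
      using rh_in by (intro AE_I2) (auto intro!: member_le_sum)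
    show "(\<lambda>\<omega>. sq_dist n (rh \<omega>) r) \<in> borel_measurable \<Omega>"
      using rh_measurable by (rule measurable_compose) simp
  qed
  have interp: "?L \<le> a + b * (?Q / real n)"
    if "0 \<le> a" "0 \<le> b" and le: "\<And>p. p \<in> rank_space n c \<Longrightarrow> loss q n p r \<le> a + b * (sq_dist n p r / real n)"
    for a b
  proof -
    have "?L \<le> expectation (\<lambda>\<omega>. a + b * (sq_dist n (rh \<omega>) r / real n))"
      using that int rh_in by (intro integral_mono') auto
    also have "\<dots> = a + b * (?Q / real n)" using int by (simp add: prob_space)
    finally show ?thesis .
  qed
  have diam: "?L \<le> real n powr q"
    using interp[of "real n powr q" 0] loss_le_diameter[OF n_pos q(1) _ r_in] by simp
  consider "s > 1" | "\<beta> = 0" | "\<beta> \<noteq> 0" "s \<le> 1" by linarith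
  then have "?L \<le> (181 + D) * rate q n \<beta> \<sigma> 0"
  proof cases
    case 1
    have "?L \<le> 0 + 1 * (?Q / real n)"
      using loss_le_sq_dist[OF n_pos q(2)] by (intro interp) auto
    also have "\<dots> \<le> 180 * (real n * exp (- s)) / real n"
      unfolding mult_1 add_0_left using 1 unfolding s_def
      by (intro divide_right_mono expected_sq_dist_le_high_snr) auto
    also have "\<dots> = 180 * exp (- s)" using n_pos by simp
    also have "\<dots> \<le> (181 + D) * exp (- s)" using D by (intro mult_right_mono) auto
    finally show ?thesis using 1 by (simp add: rate_def s_def)
  next
    case 2
    have "1 * real n powr q \<le> (181 + D) * real n powr q" using D by (intro mult_right_mono) auto
    with diam show ?thesis using 2 by (simp add: rate_def snr_def)
  next
    case 3
    then have s0: "0 < s" using n_pos sigma_pos by (simp add: s_def snr_def)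
    let ?l = "s powr (- 1 / 2)"
    have "?L \<le> ?l powr q + ?l powr (q - 2) * (?Q / real n)"
      using s0 by (intro interp loss_le_interpolated n_pos q) auto
    also have "?Q / real n \<le> D * (real n / s) / real n"
      using expected_sq_dist_le_low_snr[OF upper M] 3
      by (intro divide_right_mono) (auto simp: D_def s_def)
    also have "D * (real n / s) / real n = D / s" using n_pos by simp
    also have "?l powr q + ?l powr (q - 2) * (D / s) = (1 + D) * s powr (- q / 2)"
    proof -
      have l_q: "?l powr q = s powr (- q / 2)" by (simp add: powr_powr)
      have "?l powr (q - 2) = s powr (- q / 2 + 1)" by (simp add: powr_powr diff_divide_distrib)
      also have "\<dots> = s powr (- q / 2) * s" using s0 powr_add[of s "- q / 2" 1] by simp
      finally show ?thesis unfolding l_q using s0 by (simp add: algebra_simps)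
    qed
    also have "\<dots> \<le> (181 + D) * s powr (- q / 2)" by (intro mult_right_mono) auto
    finally have "?L \<le> (181 + D) * s powr (- q / 2)" by (simp add: mult_left_mono)
    moreover have "1 * real n powr q \<le> (181 + D) * real n powr q" using D by (intro mult_right_mono) auto
    ultimately have "?L \<le> (181 + D) * min (s powr (- q / 2)) (real n powr q)"
      using diam by (auto simp: min_def)
    then show ?thesis using 3 by (simp add: rate_def s_def)
  qed
  then show ?thesis by (simp add: D_def)
qed

section \<open>Risk of the least-squares estimator\<close>

theorem theorem2p2:
  fixes q M :: real
    and c \<sigma> \<beta> :: "nat \<Rightarrow> real"
    and \<mu> :: "nat \<Rightarrow> nat \<Rightarrow> nat \<Rightarrow> real"
    and \<Omega> :: "nat \<Rightarrow> 'a measure"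
    and Z :: "nat \<Rightarrow> nat \<Rightarrow> nat \<Rightarrow> 'a \<Rightarrow> real"
    and rhat :: "nat \<Rightarrow> (nat \<times> nat \<Rightarrow> real) \<Rightarrow> nat \<Rightarrow> nat"
  assumes "0 \<le> q" "q \<le> 2"
    and "M > 1"
    and "\<And>n. n \<ge> 1 \<Longrightarrow> 1 \<le> c n"
    and "c \<in> o(\<lambda>n. sqrt (real n))"
    and "\<And>n. n \<ge> 1 \<Longrightarrow> \<sigma> n > 0"
    and "\<And>n. n \<ge> 1 \<Longrightarrow> prob_space (\<Omega> n)"
    and "\<And>n i j. n \<ge> 1 \<Longrightarrow> (i, j) \<in> offdiag n \<Longrightarrow> Z n i j \<in> borel_measurable (\<Omega> n)"
    and "\<And>n. n \<ge> 1 \<Longrightarrow> noise_condition n (\<Omega> n) (Z n) (\<sigma> n)"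
    and "\<And>n. n \<ge> 1 \<Longrightarrow> signal_condition n (c n) (\<mu> n) (\<beta> n)"
    and "\<And>n. n \<ge> 1 \<Longrightarrow> upper_signal_condition n (c n) (\<mu> n) (\<beta> n) M"
    and "\<And>n. n \<ge> 1 \<Longrightarrow> least_squares_estimator n (c n) (\<mu> n) (rhat n)"
  shows "\<exists>C>0. \<exists>\<eta> :: nat \<Rightarrow> real. \<eta> \<longlonglongrightarrow> 0 \<and>
    (\<forall>n\<ge>1. (SUP r \<in> rank_space n (c n).
        integral\<^sup>L (obs_law n (\<Omega> n) (Z n) (\<mu> n) r) (\<lambda>x. loss q n (rhat n x) r))
      \<le> C * rate q n (\<beta> n) (\<sigma> n) (\<eta> n))"
proof -
  define C where "C = 181 + ((16 * sqrt M * (480 * sqrt M + 4))\<^sup>2 + 2304 * M + 4)"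
  \<comment> \<open>The bound holds with \<open>\<eta> = 0\<close>.\<close>
  have "0 < C" using \<open>M > 1\<close> unfolding C_def by (intro add_pos_nonneg) auto
  have risk: "integral\<^sup>L (obs_law n (\<Omega> n) (Z n) (\<mu> n) r) (\<lambda>x. loss q n (rhat n x) r)
      \<le> C * rate q n (\<beta> n) (\<sigma> n) 0"
    if n: "n \<ge> 1" and r: "r \<in> rank_space n (c n)" for n r
  proof -
    define T where "T = (\<lambda>\<omega>. \<lambda>(i, j)\<in>offdiag n. \<mu> n (r i) (r j) + Z n i j \<omega>)"
    have T: "T \<in> measurable (\<Omega> n) (obs_space n)"
      unfolding T_def
    proof (rule measurable_restrict)
      fix e assume e: "e \<in> offdiag n"
      obtain i j where ij: "e = (i, j)" by (cases e)
      show "(\<lambda>\<omega>. case e of (i, j) \<Rightarrow> \<mu> n (r i) (r j) + Z n i j \<omega>) \<in> measurable (\<Omega> n) borel"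
        using assms(8)[OF n, of i j] e unfolding ij by (auto intro: borel_measurable_add)
    qed
    have rhat: "rhat n \<in> measurable (obs_space n) (count_space (rank_space n (c n)))"
      and arg_min: "\<And>x. x \<in> space (obs_space n) \<Longrightarrow>
        is_arg_min (\<lambda>r. \<Sum>(i, j)\<in>offdiag n. (x (i, j) - \<mu> n (r i) (r j))\<^sup>2)
          (\<lambda>r. r \<in> rank_space n (c n)) (rhat n x)"
      using assms(12)[OF n] unfolding least_squares_estimator_def by blast+
    interpret prob_space "\<Omega> n" by (rule assms(7)[OF n])
    interpret least_squares_fit "\<Omega> n" n "Z n" "\<sigma> n" "c n" "\<mu> n" "\<beta> n" r "\<lambda>\<omega>. rhat n (T \<omega>)"
    proof
      fix \<omega> assume "\<omega> \<in> space (\<Omega> n)"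
      then have "T \<omega> \<in> space (obs_space n)" using T by (auto dest: measurable_space)
      from arg_min[OF this] have in_R: "rhat n (T \<omega>) \<in> rank_space n (c n)"
        and le: "(\<Sum>(i, j)\<in>offdiag n. (T \<omega> (i, j) - \<mu> n (rhat n (T \<omega>) i) (rhat n (T \<omega>) j))\<^sup>2)
          \<le> (\<Sum>(i, j)\<in>offdiag n. (T \<omega> (i, j) - \<mu> n (r i) (r j))\<^sup>2)"
        using r by (auto simp: is_arg_min_linorder)
      show "rhat n (T \<omega>) \<in> rank_space n (c n)" by (rule in_R)
      have T_eq: "(\<Sum>(i, j)\<in>offdiag n. (T \<omega> (i, j) - \<mu> n (p i) (p j))\<^sup>2)
          = (\<Sum>(i, j)\<in>offdiag n. (\<mu> n (r i) (r j) + Z n i j \<omega> - \<mu> n (p i) (p j))\<^sup>2)" for p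
        by (rule sum.cong) (auto simp: T_def)
      show "signal_diff n (\<mu> n) (rhat n (T \<omega>)) r
          \<le> 2 * (noise_corr n (Z n) (\<mu> n) (rhat n (T \<omega>)) \<omega> - noise_corr n (Z n) (\<mu> n) r \<omega>)"
        using le unfolding T_eq by (rule least_squares_basic_inequality)
    qed (use n r assms in auto)
    have "integral\<^sup>L (obs_law n (\<Omega> n) (Z n) (\<mu> n) r) (\<lambda>x. loss q n (rhat n x) r)
        = expectation (\<lambda>\<omega>. loss q n (rhat n (T \<omega>)) r)"
      unfolding obs_law_def T_def[symmetric]
      by (rule integral_distr[OF T]) (rule measurable_compose[OF rhat], simp)
    also have "\<dots> \<le> C * rate q n (\<beta> n) (\<sigma> n) 0"
      unfolding C_def
      by (rule expected_loss_le[OF assms(11)[OF n] \<open>M > 1\<close> assms(1,2) measurable_compose[OF T rhat]])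
    finally show ?thesis .
  qed
  have "(SUP r \<in> rank_space n (c n).
        integral\<^sup>L (obs_law n (\<Omega> n) (Z n) (\<mu> n) r) (\<lambda>x. loss q n (rhat n x) r))
      \<le> C * rate q n (\<beta> n) (\<sigma> n) 0" if n: "n \<ge> 1" for n
  proof (rule cSUP_least[OF _ risk[OF n]])
    have "(\<lambda>i\<in>{1..n}. i) \<in> rank_space n (c n)"
      using assms(4)[OF n] by (auto simp: rank_space_def)
    then show "rank_space n (c n) \<noteq> {}" by blast
  qed
  with \<open>0 < C\<close> show ?thesis by (intro exI[of _ C] conjI exI[of _ "\<lambda>_. 0"]) auto
qed

end
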